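(* Let $L\ge 1$ and consider the Fourier neural operator (FNO) $G_\theta(\boldsymbol{x},\boldsymbol{y})$ of depth $L$ defined in the context, where the input field $a(\boldsymbol{x},\boldsymbol{y})$ is either the affine field or the Chebyshev field with basis functions $\psi_j$. Suppose there exist positive sequences $(\beta_j)_{j\ge1}$, $(R_\ell)_{\ell\ge1}$, $(A_n)_{n\ge1}$ such that $$\|\psi_j\|_\infty\le\beta_j\ (j=1,\dots,s),\qquad \|W_\ell\|_\infty+\sum_{\boldsymbol{h}\in\mathcal{A}}\|\widehat{\kappa_\ell}(\boldsymbol{h})\|_\infty\le R_\ell\ (\ell=1,\dots,L),\qquad \|\sigma^{(n)}\|_\infty\le A_n\ (n\ge1).$$ Suppose additionally that $A_n=\xi\,\tau^n\,n!$ for all $n\ge 1$, for some $\xi>0$ and $\tau>0$. Define $$\Pi_k:=\prod_{t=1}^k(\xi\,\tau\,R_t),\qquad S_L:=\frac1\xi\sum_{k=1}^L\Pi_k,\qquad C_L:=\max\Big\{\|G_\theta\|_\infty,\ \|Q\|_\infty\frac{\Pi_L}{S_L}\Big\}.$$ Then for every multiindex $\boldsymbol{\nu}\in\mathbb{N}_0^s$, including $\boldsymbol{\nu}=\boldsymbol{0}$: (a) if $a$ is the affine field, then $$\|\partial^{\boldsymbol{\nu}}_{\boldsymbol{y}}G_\theta\|_\infty\le C_L\,|\boldsymbol{\nu}|!\,(\|P\|_\infty\,S_L\,\boldsymbol{\beta})^{\boldsymbol{\nu}};$$ (b) if $a$ is the Chebyshev field, then $$\|\partial^{\boldsymbol{\nu}}_{\boldsymbol{y}}G_\theta\|_\infty\le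 C_L\,(2\pi)^{|\boldsymbol{\nu}|}\sum_{\boldsymbol{m}\le\boldsymbol{\nu}}|\boldsymbol{m}|!\,(\|P\|_\infty\,S_L\,\boldsymbol{\beta})^{\boldsymbol{m}}\,\mathcal{S}(\boldsymbol{\nu},\boldsymbol{m}).$$
   Context: **Domains and fields.** $D=[0,1]^d$, $Y=[0,1]^s$. Let $\psi_0,\dots,\psi_s:D\to\mathbb{C}$ be bounded measurable functions. The affine field is $a(\boldsymbol{x},\boldsymbol{y})=\psi_0(\boldsymbol{x})+\sum_{j=1}^s(y_j-\tfrac12)\psi_j(\boldsymbol{x})$; the Chebyshev field is $a(\boldsymbol{x},\boldsymbol{y})=\psi_0(\boldsymbol{x})+\sum_{j=1}^s\sin(2\pi y_j)\,\psi_j(\boldsymbol{x})$, for $\boldsymbol{x}\in D$, $\boldsymbol{y}\in Y$. **FNO.** Let $d_1,\dots,d_{L+1},d_u$ be positive integers and $\mathcal{A}\subset\mathbb{Z}^d$ a finite frequency index set. The parameters $\theta$ are $P\in\mathbb{R}^{d_1\times1}$, $Q\in\mathbb{R}^{d_u\times d_{L+1}}$ and, for $\ell=1,\dots,L$, $W_\ell\in\mathbb{R}^{d_{\ell+1}\times d_\ell}$, $b_\ell\in\mathbb{R}^{d_{\ell+1}}$, $\widehat{\kappa_\ell}(\boldsymbol{h})\in\mathbb{C}^{d_{\ell+1}\times d_\ell}$ ($\boldsymbol{h}\in\mathcal{A}$). The activation function $\sigma:\mathbb{R}\to\mathbb{R}$ is infinitely differentiable; it is applied componentwise to vectors, and to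 complex numbers by $\sigma(z)=\sigma(\mathrm{Re}\,z)+\mathrm{i}\,\sigma(\mathrm{Im}\,z)$; $\sigma^{(n)}$ is the $n$th derivative of the real function. For $v:D\to\mathbb{C}^{d_\ell}$ put $$(K_\ell v)(\boldsymbol{x})=\sum_{\boldsymbol{h}\in\mathcal{A}}\widehat{\kappa_\ell}(\boldsymbol{h})\,\widehat v(\boldsymbol{h})\,e^{2\pi\mathrm{i}\boldsymbol{h}\cdot\boldsymbol{x}},\qquad \widehat v(\boldsymbol{h})=\int_Dv(\boldsymbol{x})e^{-2\pi\mathrm{i}\boldsymbol{h}\cdot\boldsymbol{x}}\,\mathrm{d}\boldsymbol{x}.$$ The FNO is $G_\theta(\boldsymbol{x},\boldsymbol{y}):=Q\,\sigma(g^{[L]}(\boldsymbol{x},\boldsymbol{y}))$, where $$g^{[1]}(\boldsymbol{x},\boldsymbol{y}):=W_1P\,a(\boldsymbol{x},\boldsymbol{y})+(K_1P\,a(\cdot,\boldsymbol{y}))(\boldsymbol{x})+b_1,$$ $$g^{[\ell]}(\boldsymbol{x},\boldsymbol{y}):=W_\ell\,\sigma(g^{[\ell-1]}(\boldsymbol{x},\boldsymbol{y}))+(K_\ell\,\sigma(g^{[\ell-1]}(\cdot,\boldsymbol{y})))(\boldsymbol{x})+b_\ell\quad(2\le\ell\le L).$$ **Norms and notation.** For a matrix, $\|\cdot\|_\infty$ is the matrix $\infty$-norm (maximum absolute row sum); for a scalar function it is the sup-norm; for $G_\theta$ and its derivatives it means the vector $\infty$-norm followed by the sup over $D$ and $Y$.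 For multiindices, $|\boldsymbol{\nu}|=\sum_j\nu_j$, $\boldsymbol{m}\le\boldsymbol{\nu}$ is componentwise (with $\boldsymbol{m}$ having nonnegative integer entries), $\boldsymbol{\beta}^{\boldsymbol{\nu}}=\prod_j\beta_j^{\nu_j}$, $(c\boldsymbol{\beta})^{\boldsymbol{\nu}}=\prod_j(c\beta_j)^{\nu_j}$, $\partial_{\boldsymbol{y}}^{\boldsymbol{\nu}}=\prod_{j=1}^s(\partial/\partial y_j)^{\nu_j}$. $\mathcal{S}(n,k)$ is the Stirling number of the second kind ($\mathcal{S}(n,0)=\delta_{n,0}$, $\mathcal{S}(n,k)=0$ for $k>n$) and $\mathcal{S}(\boldsymbol{\nu},\boldsymbol{m})=\prod_j\mathcal{S}(\nu_j,m_j)$. *)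

theory Defs
  imports "HOL-Analysis.Analysis" "HOL-Combinatorics.Stirling"
begin

text \<open>
  The spatial domain \<open>D\<close> is \<open>cbox 0 1\<close> in \<open>real ^ 'd\<close>. Everything else whose dimension varies
  (parameters \<open>y\<close>, layer vectors, matrices, multiindices) is a function on \<open>nat\<close>, of which only
  the entries with indices \<open>1..n\<close> are meaningful.
\<close>

definition mat_vec :: "nat \<Rightarrow> (nat \<Rightarrow> nat \<Rightarrow> complex) \<Rightarrow> (nat \<Rightarrow> complex) \<Rightarrow> nat \<Rightarrow> complex" where
  "mat_vec n M v = (\<lambda>i. \<Sum>j=1..n. M i j * v j)"

definition cmat :: "(nat \<Rightarrow> nat \<Rightarrow> real) \<Rightarrow> nat \<Rightarrow> nat \<Rightarrow> complex" where
  "cmat M = (\<lambda>i j. complex_of_real (M i j))"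

text \<open>The two norms below are only used for \<open>m, n \<ge> 1\<close> (\<open>Max\<close> of the empty set is unspecified).\<close>

definition vec_inf_norm :: "nat \<Rightarrow> (nat \<Rightarrow> 'a::real_normed_vector) \<Rightarrow> real" where
  "vec_inf_norm n v = Max ((\<lambda>i. norm (v i)) ` {1..n})"

definition mat_inf_norm :: "nat \<Rightarrow> nat \<Rightarrow> (nat \<Rightarrow> nat \<Rightarrow> 'a::real_normed_vector) \<Rightarrow> real" where
  "mat_inf_norm m n M = Max ((\<lambda>i. \<Sum>j=1..n. norm (M i j)) ` {1..m})"

definition param_cube :: "nat \<Rightarrow> (nat \<Rightarrow> real) set" where
  "param_cube s = ({1..s} \<rightarrow>\<^sub>E {0..1})"

definition affine_field ::
    "nat \<Rightarrow> (nat \<Rightarrow> real ^ 'd \<Rightarrow> complex) \<Rightarrow> real ^ 'd \<Rightarrow> (nat \<Rightarrow> real) \<Rightarrow> complex" where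
  "affine_field s \<psi> x y = \<psi> 0 x + (\<Sum>j=1..s. complex_of_real (y j - 1/2) * \<psi> j x)"

definition chebyshev_field ::
    "nat \<Rightarrow> (nat \<Rightarrow> real ^ 'd \<Rightarrow> complex) \<Rightarrow> real ^ 'd \<Rightarrow> (nat \<Rightarrow> real) \<Rightarrow> complex" where
  "chebyshev_field s \<psi> x y = \<psi> 0 x + (\<Sum>j=1..s. complex_of_real (sin (2 * pi * y j)) * \<psi> j x)"

text \<open>
  \<open>width \<theta> l\<close> is \<open>d\<^sub>l\<close>; \<open>lift_mat\<close>, \<open>proj_mat\<close>, \<open>weight\<close>, \<open>bias\<close> and \<open>kernel_hat\<close> are
  \<open>P\<close>, \<open>Q\<close>, \<open>W\<close>, \<open>b\<close> and the Fourier coefficients of the kernels. The depth is not part of the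
  record: a network of depth \<open>L\<close> only reads the layers \<open>1..L\<close>.
\<close>

record 'd fno_params =
  width :: "nat \<Rightarrow> nat"
  out_dim :: nat
  freqs :: "(int ^ 'd) set"
  lift_mat :: "nat \<Rightarrow> nat \<Rightarrow> real"
  proj_mat :: "nat \<Rightarrow> nat \<Rightarrow> real"
  weight :: "nat \<Rightarrow> nat \<Rightarrow> nat \<Rightarrow> real"
  bias :: "nat \<Rightarrow> nat \<Rightarrow> real"
  kernel_hat :: "nat \<Rightarrow> int ^ 'd \<Rightarrow> nat \<Rightarrow> nat \<Rightarrow> complex"

definition freq_dot :: "int ^ 'd \<Rightarrow> real ^ 'd \<Rightarrow> real" where
  "freq_dot h x = (\<Sum>k\<in>UNIV. real_of_int (h $ k) * x $ k)"

definition fourier_coeff :: "(real ^ 'd \<Rightarrow> complex) \<Rightarrow> int ^ 'd \<Rightarrow> complex" where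
  "fourier_coeff v h =
     (LINT x|lebesgue_on (cbox 0 1). v x * exp (- (2 * pi * \<i> * complex_of_real (freq_dot h x))))"

definition kernel_op ::
    "'d fno_params \<Rightarrow> nat \<Rightarrow> (real ^ 'd \<Rightarrow> nat \<Rightarrow> complex) \<Rightarrow> real ^ 'd \<Rightarrow> nat \<Rightarrow> complex" where
  "kernel_op \<theta> l v x = (\<lambda>i. \<Sum>h\<in>freqs \<theta>.
     mat_vec (width \<theta> l) (kernel_hat \<theta> l h) (\<lambda>j. fourier_coeff (\<lambda>z. v z j) h) i
       * exp (2 * pi * \<i> * complex_of_real (freq_dot h x)))"

definition fno_layer ::
    "'d fno_params \<Rightarrow> nat \<Rightarrow> (real ^ 'd \<Rightarrow> nat \<Rightarrow> complex) \<Rightarrow> real ^ 'd \<Rightarrow> nat \<Rightarrow> complex" where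
  "fno_layer \<theta> l v x = (\<lambda>i.
     mat_vec (width \<theta> l) (cmat (weight \<theta> l)) (v x) i + kernel_op \<theta> l v x i
       + complex_of_real (bias \<theta> l i))"

definition complex_act :: "(real \<Rightarrow> real) \<Rightarrow> complex \<Rightarrow> complex" where
  "complex_act \<sigma> z = Complex (\<sigma> (Re z)) (\<sigma> (Im z))"

text \<open>\<open>pre_act \<theta> \<sigma> f l\<close> is \<open>g\<^bsup>[l]\<^esup>\<close> for the input function \<open>f\<close> = \<open>a(\<cdot>, y)\<close>; the value at
  \<open>l = 0\<close> is a dummy.\<close>

fun pre_act ::
    "'d fno_params \<Rightarrow> (real \<Rightarrow> real) \<Rightarrow> (real ^ 'd \<Rightarrow> complex) \<Rightarrow> nat \<Rightarrow> real ^ 'd \<Rightarrow> nat \<Rightarrow> complex"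
where
  "pre_act \<theta> \<sigma> f 0 = (\<lambda>x i. 0)"
| "pre_act \<theta> \<sigma> f (Suc 0) = fno_layer \<theta> 1 (\<lambda>x. mat_vec 1 (cmat (lift_mat \<theta>)) (\<lambda>_. f x))"
| "pre_act \<theta> \<sigma> f (Suc (Suc l)) =
     fno_layer \<theta> (Suc (Suc l)) (\<lambda>x i. complex_act \<sigma> (pre_act \<theta> \<sigma> f (Suc l) x i))"

definition fno ::
    "nat \<Rightarrow> 'd fno_params \<Rightarrow> (real \<Rightarrow> real) \<Rightarrow> (real ^ 'd \<Rightarrow> (nat \<Rightarrow> real) \<Rightarrow> complex)
      \<Rightarrow> real ^ 'd \<Rightarrow> (nat \<Rightarrow> real) \<Rightarrow> nat \<Rightarrow> complex" where
  "fno L \<theta> \<sigma> a x y =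
     mat_vec (width \<theta> (L + 1)) (cmat (proj_mat \<theta>))
       (\<lambda>i. complex_act \<sigma> (pre_act \<theta> \<sigma> (\<lambda>z. a z y) L x i))"

text \<open>Sup-norms take values in \<open>ennreal\<close>, so that the norm of an unbounded function is \<open>\<infinity>\<close>.\<close>

definition sup_norm :: "'a set \<Rightarrow> ('a \<Rightarrow> 'b::real_normed_vector) \<Rightarrow> ennreal" where
  "sup_norm S f = (SUP x\<in>S. ennreal (norm (f x)))"

definition field_norm ::
    "nat \<Rightarrow> nat \<Rightarrow> (real ^ 'd \<Rightarrow> (nat \<Rightarrow> real) \<Rightarrow> nat \<Rightarrow> complex) \<Rightarrow> ennreal" where
  "field_norm n s G = (SUP x\<in>cbox 0 1. SUP y\<in>param_cube s. ennreal (vec_inf_norm n (G x y)))"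

text \<open>Derivatives are taken within \<open>{0..1}\<close>, hence are one-sided on the faces of the cube.\<close>

definition partial_y :: "nat \<Rightarrow> ((nat \<Rightarrow> real) \<Rightarrow> complex) \<Rightarrow> (nat \<Rightarrow> real) \<Rightarrow> complex" where
  "partial_y j F y = vector_derivative (\<lambda>t. F (y(j := t))) (at (y j) within {0..1})"

definition mixed_partial ::
    "nat \<Rightarrow> (nat \<Rightarrow> nat) \<Rightarrow> ((nat \<Rightarrow> real) \<Rightarrow> complex) \<Rightarrow> (nat \<Rightarrow> real) \<Rightarrow> complex" where
  "mixed_partial s \<nu> F = foldr (\<lambda>j. partial_y j ^^ \<nu> j) [1..<Suc s] F"

definition deriv_y ::
    "nat \<Rightarrow> (nat \<Rightarrow> nat) \<Rightarrow> (real ^ 'd \<Rightarrow> (nat \<Rightarrow> real) \<Rightarrow> nat \<Rightarrow> complex)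
      \<Rightarrow> real ^ 'd \<Rightarrow> (nat \<Rightarrow> real) \<Rightarrow> nat \<Rightarrow> complex" where
  "deriv_y s \<nu> G x y = (\<lambda>i. mixed_partial s \<nu> (\<lambda>y'. G x y' i) y)"

text \<open>All iterated partial derivatives exist, in whatever order they are taken. (\<open>vector_derivative\<close>
  is total, so this has to be expressed separately.)\<close>

definition has_all_partials :: "nat \<Rightarrow> ((nat \<Rightarrow> real) \<Rightarrow> complex) \<Rightarrow> bool" where
  "has_all_partials s F \<longleftrightarrow>
     (\<forall>js. set js \<subseteq> {1..s} \<longrightarrow>
       (\<forall>j\<in>{1..s}. \<forall>y\<in>param_cube s.
          (\<lambda>t. foldr partial_y js F (y(j := t))) differentiable (at (y j) within {0..1})))"

definition mi_order :: "nat \<Rightarrow> (nat \<Rightarrow> nat) \<Rightarrow> nat" where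
  "mi_order s \<nu> = (\<Sum>j=1..s. \<nu> j)"

definition mi_power :: "nat \<Rightarrow> (nat \<Rightarrow> real) \<Rightarrow> (nat \<Rightarrow> nat) \<Rightarrow> real" where
  "mi_power s b \<nu> = (\<Prod>j=1..s. b j ^ \<nu> j)"

definition mi_below :: "nat \<Rightarrow> (nat \<Rightarrow> nat) \<Rightarrow> (nat \<Rightarrow> nat) set" where
  "mi_below s \<nu> = (\<Pi>\<^sub>E j\<in>{1..s}. {0..\<nu> j})"

definition mi_Stirling :: "nat \<Rightarrow> (nat \<Rightarrow> nat) \<Rightarrow> (nat \<Rightarrow> nat) \<Rightarrow> nat" where
  "mi_Stirling s \<nu> m = (\<Prod>j=1..s. Stirling (\<nu> j) (m j))"

definition Pi_const :: "real \<Rightarrow> real \<Rightarrow> (nat \<Rightarrow> real) \<Rightarrow> nat \<Rightarrow> real" where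
  "Pi_const \<xi> \<tau> R k = (\<Prod>t=1..k. \<xi> * \<tau> * R t)"

definition S_const :: "real \<Rightarrow> real \<Rightarrow> (nat \<Rightarrow> real) \<Rightarrow> nat \<Rightarrow> real" where
  "S_const \<xi> \<tau> R L = 1 / \<xi> * (\<Sum>k=1..L. Pi_const \<xi> \<tau> R k)"

definition C_const ::
    "nat \<Rightarrow> 'd fno_params \<Rightarrow> (real \<Rightarrow> real) \<Rightarrow> nat \<Rightarrow> (real ^ 'd \<Rightarrow> (nat \<Rightarrow> real) \<Rightarrow> complex)
      \<Rightarrow> real \<Rightarrow> real \<Rightarrow> (nat \<Rightarrow> real) \<Rightarrow> ennreal" where
  "C_const L \<theta> \<sigma> s a \<xi> \<tau> R =
     max (field_norm (out_dim \<theta>) s (fno L \<theta> \<sigma> a))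
       (ennreal (mat_inf_norm (out_dim \<theta>) (width \<theta> (L + 1)) (proj_mat \<theta>)
                   * (Pi_const \<xi> \<tau> R L / S_const \<xi> \<tau> R L)))"

end

theory Submission
  imports Defs "HOL-Computational_Algebra.Formal_Power_Series"
begin

text \<open>
  The derivatives of each layer in \<open>y\<close> are controlled by a majorant: a formal power series \<open>M\<close> in one
  variable \<open>t\<close> standing for \<open>\<Sum>j. \<beta> j z\<^sub>j\<close> (affine field) or \<open>\<Sum>j. \<beta> j (e\<^bsup>2 \<pi> z\<^sub>j\<^esup> - 1)\<close>
  (Chebyshev field), multiplied in the latter case by a monomial in the exponentials. Majorants are
  compatible with sums, products, bounded linear operators and, since \<open>\<xi> / (1 - \<tau> u)\<close> majorises the
  derivatives of \<open>\<sigma>\<close> of positive order, with the activation. All maps involved are Moebius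
  transformations: if a layer has the majorant \<open>c t / (1 - b t)\<close>, the next one has
  \<open>\<xi> \<tau> R c t / (1 - (b + \<tau> R c) t)\<close>, so after \<open>L\<close> layers \<open>c\<close> and \<open>b\<close> have become \<open>\<Pi>\<^sub>L\<close> and \<open>S\<^sub>L\<close>.
  The coefficients of \<open>c t / (1 - b t)\<close> give the bounds; expanding the powers of \<open>e\<^bsup>2 \<pi> z\<^sub>j\<^esup> - 1\<close>
  produces the Stirling numbers.
\<close>

text \<open>The obstacle is the Fourier term of a layer: differentiating it in the parameters needs
  estimates that are uniform in the spatial variable. A jet therefore carries existence,
  measurability and uniform bounds of the derivatives together. Since the single variable t stands
  for all parameters, the multivariate product and chain rules collapse to identities between
  one-variable series, and the factorial of |\<nu>| is that of the |\<nu>|-th derivative in t.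
  Derivatives are taken on the whole real parameter space, where both fields make sense and all
  derivatives of positive order stay bounded; the cube with its one-sided derivatives enters by
  agreement on the cube. The values themselves have only local bounds, because no bound on \<sigma>
  is assumed. Hence order zero is treated apart, and C_L is a maximum with the norm of the
  network.\<close>

unbundle no vec_syntax and fps_syntax

section \<open>Jets and their majorants\<close>

text \<open>The complex activation acts on real and imaginary parts separately, so its chain rule involves the
  componentwise product, which is submultiplicative for the Euclidean norm although its unit
  \<open>1 + \<i>\<close> has norm \<open>sqrt 2\<close>.\<close>

definition star :: "complex \<Rightarrow> complex \<Rightarrow> complex" where
  "star z w = Complex (Re z * Re w) (Im z * Im w)"

lemma norm_star_le: "norm (star z w) \<le> norm z * norm w"
proof -
  have "(Re z * Re w)\<^sup>2 + (Im z * Im w)\<^sup>2 \<le> ((Re z)\<^sup>2 + (Im z)\<^sup>2) * ((Re w)\<^sup>2 + (Im w)\<^sup>2)"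
    by (simp add: algebra_simps power_mult_distrib)
  then show ?thesis
    by (simp add: star_def cmod_def flip: real_sqrt_mult)
qed

interpretation star: bounded_bilinear star
proof
  show "\<exists>K. \<forall>a b. norm (star a b) \<le> norm a * norm b * K"
    using norm_star_le by (metis mult.right_neutral)
qed (simp_all add: star_def complex_eq_iff algebra_simps)

lemma star_assoc: "star (star z w) u = star z (star w u)"
  by (simp add: star_def mult.assoc)

lemma borel_measurable_star:
  assumes "f \<in> borel_measurable N" "g \<in> borel_measurable N"
  shows "(\<lambda>p. star (f p) (g p)) \<in> borel_measurable N"
  using assms by (auto simp: star_def borel_measurable_complex_iff)

text \<open>\<open>norm_star_le\<close> would cost a factor sqrt 2 here, because
  \<open>complex_act f z\<close> may have norm \<open>sqrt 2 * c\<close>. Estimating the two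
  components separately keeps the constant of \<open>f\<close>, so no such factor accumulates over
  the layers.\<close>

lemma norm_star_complex_act_le:
  assumes "\<And>t. \<bar>f t\<bar> \<le> c"
  shows "norm (star (complex_act f z) w) \<le> c * norm w"
proof -
  have c: "c \<ge> 0"
    using assms[of 0] by linarith
  have "(f (Re z) * Re w)\<^sup>2 \<le> c\<^sup>2 * (Re w)\<^sup>2" "(f (Im z) * Im w)\<^sup>2 \<le> c\<^sup>2 * (Im w)\<^sup>2"
    using assms by (auto simp: power_mult_distrib intro!: mult_right_mono abs_le_square_iff[THEN iffD1] order_trans[OF assms])
  then have "(f (Re z) * Re w)\<^sup>2 + (f (Im z) * Im w)\<^sup>2 \<le> c\<^sup>2 * ((Re w)\<^sup>2 + (Im w)\<^sup>2)"
    by (simp add: algebra_simps)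
  then have "norm (star (complex_act f z) w) \<le> sqrt (c\<^sup>2 * ((Re w)\<^sup>2 + (Im w)\<^sup>2))"
    by (simp add: star_def complex_act_def cmod_def)
  also have "\<dots> = c * norm w"
    using c by (simp add: real_sqrt_mult cmod_def)
  finally show ?thesis .
qed

lemma borel_measurable_complex_act:
  assumes "continuous_on UNIV f" "g \<in> borel_measurable N"
  shows "(\<lambda>p. complex_act f (g p)) \<in> borel_measurable N"
proof -
  have "f \<in> borel_measurable borel"
    using assms(1) by (rule borel_measurable_continuous_onI)
  moreover have "(\<lambda>p. Re (g p)) \<in> borel_measurable N" "(\<lambda>p. Im (g p)) \<in> borel_measurable N"
    using assms(2) by (simp_all add: borel_measurable_complex_iff)
  ultimately show ?thesis
    by (simp add: complex_act_def borel_measurable_complex_iff measurable_compose)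
qed

lemma has_vector_derivative_complex_act:
  assumes f: "\<And>t. (f has_real_derivative f' t) (at t)"
    and g: "(g has_vector_derivative g') (at t)"
  shows "((\<lambda>t. complex_act f (g t)) has_vector_derivative star (complex_act f' (g t)) g') (at t)"
proof -
  have "((\<lambda>t. Re (g t)) has_real_derivative Re g') (at t)"
    "((\<lambda>t. Im (g t)) has_real_derivative Im g') (at t)"
    using g by (simp_all add: has_vector_derivative_complex_iff)
  from this[THEN DERIV_chain2[OF f]] show ?thesis
    by (simp add: has_vector_derivative_complex_iff complex_act_def star_def)
qed

text \<open>The vector \<open>w\<close> is arbitrary, since both input fields extend beyond the
  cube; so derivatives are two-sided. The point \<open>p\<close> is a separate argument because the
  operators act on functions of \<open>p\<close>.\<close>

definition has_partial ::
    "'p measure \<Rightarrow> nat \<Rightarrow> ('p \<Rightarrow> (nat \<Rightarrow> real) \<Rightarrow> complex) \<Rightarrow> ('p \<Rightarrow> (nat \<Rightarrow> real) \<Rightarrow> complex) \<Rightarrow> bool"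
where
  "has_partial N j F F' \<longleftrightarrow> (\<forall>p\<in>space N. \<forall>w.
     ((\<lambda>t. F p (w(j := t))) has_vector_derivative F' p w) (at (w j)))"

text \<open>Measurability in \<open>p\<close> is carried along for the integrals in the Fourier
  coefficients.\<close>

definition meas_bounded ::
    "'p measure \<Rightarrow> real \<Rightarrow> ('p \<Rightarrow> (nat \<Rightarrow> real) \<Rightarrow> complex) \<Rightarrow> bool" where
  "meas_bounded N c F \<longleftrightarrow>
     (\<forall>w. (\<lambda>p. F p w) \<in> borel_measurable N) \<and> (\<forall>p\<in>space N. \<forall>w. norm (F p w) \<le> c)"

abbreviation incr :: "nat \<Rightarrow> (nat \<Rightarrow> nat) \<Rightarrow> nat \<Rightarrow> nat" where
  "incr j m \<equiv> m(j := Suc (m j))"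

lemma has_partial_add:
  "has_partial N j F F' \<Longrightarrow> has_partial N j G G' \<Longrightarrow>
    has_partial N j (\<lambda>p w. F p w + G p w) (\<lambda>p w. F' p w + G' p w)"
  by (auto simp: has_partial_def intro!: has_vector_derivative_add)

lemma has_partial_star:
  assumes "has_partial N j F F'" "has_partial N j G G'"
  shows "has_partial N j (\<lambda>p w. star (F p w) (G p w))
    (\<lambda>p w. star (F p w) (G' p w) + star (F' p w) (G p w))"
  unfolding has_partial_def
proof (intro ballI allI)
  fix p w assume "p \<in> space N"
  with assms have "((\<lambda>t. F p (w(j := t))) has_vector_derivative F' p w) (at (w j))"
    "((\<lambda>t. G p (w(j := t))) has_vector_derivative G' p w) (at (w j))"
    by (auto simp: has_partial_def)
  from star.has_vector_derivative[OF this]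
  show "((\<lambda>t. star (F p (w(j := t))) (G p (w(j := t)))) has_vector_derivative
      star (F p w) (G' p w) + star (F' p w) (G p w)) (at (w j))"
    by simp
qed

lemma has_partial_complex_act:
  assumes f: "\<And>t. (f has_real_derivative f' t) (at t)" and g: "has_partial N j g g'"
  shows "has_partial N j (\<lambda>p w. complex_act f (g p w)) (\<lambda>p w. star (complex_act f' (g p w)) (g' p w))"
  unfolding has_partial_def
proof (intro ballI allI)
  fix p w assume "p \<in> space N"
  with g have "((\<lambda>t. g p (w(j := t))) has_vector_derivative g' p w) (at (w j))"
    by (auto simp: has_partial_def)
  from has_vector_derivative_complex_act[OF f this]
  show "((\<lambda>t. complex_act f (g p (w(j := t)))) has_vector_derivative
      star (complex_act f' (g p w)) (g' p w)) (at (w j))"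
    by simp
qed

lemma has_partial_cong:
  assumes "has_partial N j F F'" "\<And>p w. p \<in> space N \<Longrightarrow> F p w = G p w"
    "\<And>p w. p \<in> space N \<Longrightarrow> F' p w = G' p w"
  shows "has_partial N j G G'"
  using assms by (simp add: has_partial_def)

lemma has_partial_at:
  assumes "has_partial N j F F'" "p \<in> space N"
  shows "((\<lambda>t. F p (w(j := t))) has_vector_derivative F' p (w(j := t))) (at t)"
  using assms(1)[unfolded has_partial_def, rule_format, OF assms(2), of "w(j := t)"] by simp

lemma meas_bounded_add:
  "meas_bounded N c F \<Longrightarrow> meas_bounded N d G \<Longrightarrow> meas_bounded N (c + d) (\<lambda>p w. F p w + G p w)"
  by (auto simp: meas_bounded_def intro!: order_trans[OF norm_triangle_ineq] add_mono borel_measurable_add)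

lemma meas_bounded_star:
  assumes "meas_bounded N c F" "meas_bounded N d G"
  shows "meas_bounded N (c * d) (\<lambda>p w. star (F p w) (G p w))"
  unfolding meas_bounded_def
proof (intro conjI ballI allI)
  show "(\<lambda>p. star (F p w) (G p w)) \<in> borel_measurable N" for w
    using assms by (intro borel_measurable_star) (auto simp: meas_bounded_def)
  fix p w assume p: "p \<in> space N"
  have "norm (star (F p w) (G p w)) \<le> norm (F p w) * norm (G p w)"
    by (rule norm_star_le)
  also have "\<dots> \<le> c * d"
    using assms p by (intro mult_mono') (auto simp: meas_bounded_def)
  finally show "norm (star (F p w) (G p w)) \<le> c * d" .
qed

section \<open>Jets: derivatives dominated by a one-variable power series\<close>

locale jets =
  fixes I :: "nat set" and \<alpha> :: real and \<beta> :: "nat \<Rightarrow> real"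
begin

text \<open>\<open>jet n N m M F\<close>: up to order \<open>n\<close>, \<open>F\<close> is majorised at \<open>z = 0\<close> by \<open>(\<Prod>j. e\<^bsup>\<alpha> z\<^sub>j m\<^sub>j\<^esup>) M(t)\<close>,
  where \<open>\<partial>t / \<partial>z\<^sub>j = \<beta> j e\<^bsup>\<alpha> z\<^sub>j\<^esup>\<close>. The summands \<open>F1\<close> and \<open>F2\<close> belong to the two terms of the product rule
  for this majorant. The affine field uses \<open>\<alpha> = 0\<close>, the Chebyshev field \<open>\<alpha> = 2 \<pi>\<close>. The points \<open>p\<close> will be
  pairs of a component index and a spatial point.\<close>

primrec jet ::
    "nat \<Rightarrow> 'p measure \<Rightarrow> (nat \<Rightarrow> nat) \<Rightarrow> real fps \<Rightarrow> ('p \<Rightarrow> (nat \<Rightarrow> real) \<Rightarrow> complex) \<Rightarrow> bool"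
where
  "jet 0 N m M F = meas_bounded N (M $ 0) F"
| "jet (Suc n) N m M F = (meas_bounded N (M $ 0) F \<and>
     (\<forall>j\<in>I. \<exists>F1 F2. has_partial N j F (\<lambda>p w. F1 p w + F2 p w)
        \<and> jet n N m (fps_const (\<alpha> * real (m j)) * M) F1
        \<and> jet n N (incr j m) (fps_const (\<beta> j) * fps_deriv M) F2))"

lemma jet_meas_bounded: "jet n N m M F \<Longrightarrow> meas_bounded N (M $ 0) F"
  by (cases n) auto

lemma jet_SucD: "jet (Suc n) N m M F \<Longrightarrow> jet n N m M F"
proof (induction n arbitrary: m M F)
  case (Suc n)
  show ?case
    unfolding jet.simps(2)[of n]
  proof (intro conjI ballI)
    show "meas_bounded N (M $ 0) F"
      using Suc.prems by simp
    fix j assume "j \<in> I"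
    with Suc.prems[unfolded jet.simps(2)[of "Suc n"]] show "\<exists>F1 F2. has_partial N j F (\<lambda>p w. F1 p w + F2 p w)
        \<and> jet n N m (fps_const (\<alpha> * real (m j)) * M) F1
        \<and> jet n N (incr j m) (fps_const (\<beta> j) * fps_deriv M) F2"
      using Suc.IH by blast
  qed
qed simp

lemma jet_add:
  "jet n N m M F \<Longrightarrow> jet n N m M' G \<Longrightarrow> jet n N m (M + M') (\<lambda>p w. F p w + G p w)"
proof (induction n arbitrary: m M F M' G)
  case 0
  then show ?case by (simp add: meas_bounded_add)
next
  case (Suc n)
  show ?case
    unfolding jet.simps(2)[of n]
  proof (intro conjI ballI)
    show "meas_bounded N ((M + M') $ 0) (\<lambda>p w. F p w + G p w)"
      using Suc.prems by (simp add: meas_bounded_add)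
    fix j assume j: "j \<in> I"
    obtain F1 F2 where F: "has_partial N j F (\<lambda>p w. F1 p w + F2 p w)"
      "jet n N m (fps_const (\<alpha> * real (m j)) * M) F1"
      "jet n N (incr j m) (fps_const (\<beta> j) * fps_deriv M) F2"
      using Suc.prems(1) j by auto
    obtain G1 G2 where G: "has_partial N j G (\<lambda>p w. G1 p w + G2 p w)"
      "jet n N m (fps_const (\<alpha> * real (m j)) * M') G1"
      "jet n N (incr j m) (fps_const (\<beta> j) * fps_deriv M') G2"
      using Suc.prems(2) j by auto
    have "has_partial N j (\<lambda>p w. F p w + G p w) (\<lambda>p w. (F1 p w + G1 p w) + (F2 p w + G2 p w))"
      by (rule has_partial_cong[OF has_partial_add[OF F(1) G(1)]]) auto
    moreover have "jet n N m (fps_const (\<alpha> * real (m j)) * (M + M')) (\<lambda>p w. F1 p w + G1 p w)"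
      using Suc.IH[OF F(2) G(2)] by (simp add: distrib_left)
    moreover have "jet n N (incr j m) (fps_const (\<beta> j) * fps_deriv (M + M')) (\<lambda>p w. F2 p w + G2 p w)"
      using Suc.IH[OF F(3) G(3)] by (simp only: distrib_left fps_deriv_add)
    ultimately show "\<exists>H1 H2. has_partial N j (\<lambda>p w. F p w + G p w) (\<lambda>p w. H1 p w + H2 p w)
        \<and> jet n N m (fps_const (\<alpha> * real (m j)) * (M + M')) H1
        \<and> jet n N (incr j m) (fps_const (\<beta> j) * fps_deriv (M + M')) H2"
      by (intro exI[of _ "\<lambda>p w. F1 p w + G1 p w"] exI[of _ "\<lambda>p w. F2 p w + G2 p w"] conjI)
  qed
qed

text \<open>The exponential prefactors multiply, so their exponents add. In the Leibniz rule the
  terms that differentiate a prefactor are collected in \<open>H1\<close>, those that differentiate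
  \<open>M\<close> or \<open>M'\<close> in \<open>H2\<close>.\<close>

lemma jet_star:
  "jet n N m M F \<Longrightarrow> jet n N m' M' G \<Longrightarrow>
    jet n N (\<lambda>i. m i + m' i) (M * M') (\<lambda>p w. star (F p w) (G p w))"
proof (induction n arbitrary: m M F m' M' G)
  case 0
  then show ?case by (simp add: meas_bounded_star)
next
  case (Suc n)
  show ?case
    unfolding jet.simps(2)[of n]
  proof (intro conjI ballI)
    show "meas_bounded N ((M * M') $ 0) (\<lambda>p w. star (F p w) (G p w))"
      using Suc.prems by (simp add: meas_bounded_star)
    fix j assume j: "j \<in> I"
    obtain F1 F2 where F: "has_partial N j F (\<lambda>p w. F1 p w + F2 p w)"
      "jet n N m (fps_const (\<alpha> * real (m j)) * M) F1"
      "jet n N (incr j m) (fps_const (\<beta> j) * fps_deriv M) F2"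
      using Suc.prems(1) j by auto
    obtain G1 G2 where G: "has_partial N j G (\<lambda>p w. G1 p w + G2 p w)"
      "jet n N m' (fps_const (\<alpha> * real (m' j)) * M') G1"
      "jet n N (incr j m') (fps_const (\<beta> j) * fps_deriv M') G2"
      using Suc.prems(2) j by auto
    have F0: "jet n N m M F" and G0: "jet n N m' M' G"
      using Suc.prems by (auto intro: jet_SucD)
    have incr: "(\<lambda>i. m i + incr j m' i) = incr j (\<lambda>i. m i + m' i)"
      "(\<lambda>i. incr j m i + m' i) = incr j (\<lambda>i. m i + m' i)"
      by auto
    define H1 where "H1 = (\<lambda>p w. star (F p w) (G1 p w) + star (F1 p w) (G p w))"
    define H2 where "H2 = (\<lambda>p w. star (F p w) (G2 p w) + star (F2 p w) (G p w))"
    have "has_partial N j (\<lambda>p w. star (F p w) (G p w)) (\<lambda>p w. H1 p w + H2 p w)"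
      by (rule has_partial_cong[OF has_partial_star[OF F(1) G(1)]])
        (auto simp: H1_def H2_def star.add_left star.add_right)
    moreover have "jet n N (\<lambda>i. m i + m' i) (fps_const (\<alpha> * real (m j + m' j)) * (M * M')) H1"
      using jet_add[OF Suc.IH[OF F0 G(2)] Suc.IH[OF F(2) G0]]
      by (simp add: H1_def algebra_simps flip: fps_const_add fps_const_mult)
    moreover have "jet n N (incr j (\<lambda>i. m i + m' i)) (fps_const (\<beta> j) * fps_deriv (M * M')) H2"
      using jet_add[OF Suc.IH[OF F0 G(3), unfolded incr] Suc.IH[OF F(3) G0, unfolded incr]]
      by (simp add: H2_def algebra_simps)
    ultimately show "\<exists>H1 H2. has_partial N j (\<lambda>p w. star (F p w) (G p w)) (\<lambda>p w. H1 p w + H2 p w)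
        \<and> jet n N (\<lambda>i. m i + m' i) (fps_const (\<alpha> * real (m j + m' j)) * (M * M')) H1
        \<and> jet n N (incr j (\<lambda>i. m i + m' i)) (fps_const (\<beta> j) * fps_deriv (M * M')) H2"
      by blast
  qed
qed

end

section \<open>Bounded linear operators and activation functions\<close>

definition admissible :: "'p measure \<Rightarrow> ('p \<Rightarrow> complex) \<Rightarrow> bool" where
  "admissible N u \<longleftrightarrow> u \<in> borel_measurable N \<and> (\<exists>c. \<forall>p\<in>space N. norm (u p) \<le> c)"

text \<open>Linearity is demanded on admissible functions only: the integral in a Fourier
  coefficient takes the default value 0 on nonintegrable functions and is not linear there.\<close>

definition bounded_operator ::
    "'p measure \<Rightarrow> 'q measure \<Rightarrow> real \<Rightarrow> (('p \<Rightarrow> complex) \<Rightarrow> 'q \<Rightarrow> complex) \<Rightarrow> bool" where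
  "bounded_operator N N' R T \<longleftrightarrow>
     (\<forall>u. admissible N u \<longrightarrow> T u \<in> borel_measurable N') \<and>
     (\<forall>u v a b. admissible N u \<longrightarrow> admissible N v \<longrightarrow>
        (\<forall>q\<in>space N'. T (\<lambda>p. a * u p + b * v p) q = a * T u q + b * T v q)) \<and>
     (\<forall>u c. u \<in> borel_measurable N \<longrightarrow> (\<forall>p\<in>space N. norm (u p) \<le> c) \<longrightarrow>
        (\<forall>q\<in>space N'. norm (T u q) \<le> R * c))"

lemma admissible_lincomb:
  assumes "admissible N u" "admissible N v"
  shows "admissible N (\<lambda>p. a * u p + b * v p)"
proof -
  obtain c d where c: "\<And>p. p \<in> space N \<Longrightarrow> norm (u p) \<le> c" and d: "\<And>p. p \<in> space N \<Longrightarrow> norm (v p) \<le> d"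
    using assms by (auto simp: admissible_def)
  have "norm (a * u p + b * v p) \<le> norm a * c + norm b * d" if "p \<in> space N" for p
    using c[OF that] d[OF that]
    by (intro order_trans[OF norm_triangle_ineq] add_mono) (auto simp: norm_mult intro: mult_left_mono)
  moreover have "(\<lambda>p. a * u p + b * v p) \<in> borel_measurable N"
    using assms by (auto simp: admissible_def intro!: borel_measurable_add borel_measurable_times)
  ultimately show ?thesis
    unfolding admissible_def by blast
qed

lemma admissible_meas_bounded: "meas_bounded N c F \<Longrightarrow> admissible N (\<lambda>p. F p w)"
  by (auto simp: meas_bounded_def admissible_def)

lemma meas_bounded_operator:
  "bounded_operator N N' R T \<Longrightarrow> meas_bounded N c F \<Longrightarrow>
    meas_bounded N' (R * c) (\<lambda>q w. T (\<lambda>p. F p w) q)"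
  unfolding bounded_operator_def meas_bounded_def admissible_def by (intro conjI allI ballI) blast+

text \<open>A quadratic remainder that is uniform in \<open>p\<close> lets a bounded linear operator commute with the
  derivative, without any dominated convergence.\<close>

lemma has_partial_operator:
  assumes T: "bounded_operator N N' R T"
    and F: "\<And>w. admissible N (\<lambda>p. F p w)" and F': "\<And>w. admissible N (\<lambda>p. F' p w)"
    and deriv: "has_partial N j F F'"
    and lip: "\<And>p w t. p \<in> space N \<Longrightarrow> norm (F' p (w(j := t)) - F' p w) \<le> B * \<bar>t - w j\<bar>"
  shows "has_partial N' j (\<lambda>q w. T (\<lambda>p. F p w) q) (\<lambda>q w. T (\<lambda>p. F' p w) q)"
  unfolding has_partial_def has_vector_derivative_def has_derivative_within_alt
proof (intro ballI allI conjI bounded_linear_scaleR_left impI)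
  fix q w and e :: real assume q: "q \<in> space N'" and e: "e > 0"
  \<comment> \<open>Mean value estimate on the segment from \<open>w j\<close> to \<open>t\<close>,
    where the derivative deviates from its value at \<open>w j\<close> by at most the Lipschitz
    bound.\<close>
  have quad: "norm (F p (w(j := t)) - F p w - (t - w j) *\<^sub>R F' p w) \<le> B * (t - w j)\<^sup>2"
    if p: "p \<in> space N" for p t
  proof -
    have B: "norm (F' p (w(j := t')) - F' p (w(j := w j))) \<le> B * \<bar>t - w j\<bar>"
      if "t' \<in> closed_segment (w j) t" for t'
    proof (cases "t = w j")
      case True
      then show ?thesis using that by simp
    next
      case False
      \<comment> \<open>The sign of \<open>B\<close> is read off from the Lipschitz estimate at this
        \<open>t\<close>, which differs from \<open>w j\<close>.\<close>
      have "0 \<le> B * \<bar>t - w j\<bar>"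
        using lip[OF p, of w t] norm_ge_zero order_trans by blast
      with False have "B \<ge> 0"
        by (simp add: zero_le_mult_iff)
      moreover have "\<bar>t' - w j\<bar> \<le> \<bar>t - w j\<bar>"
        using that by (auto simp: closed_segment_eq_real_ivl split: if_splits)
      ultimately have "B * \<bar>t' - w j\<bar> \<le> B * \<bar>t - w j\<bar>"
        by (rule mult_left_mono[rotated])
      with lip[OF p, of w t'] show ?thesis by simp
    qed
    have "norm (F p (w(j := t)) - F p (w(j := w j)) - (t - w j) *\<^sub>R F' p (w(j := w j)))
        \<le> norm (t - w j) * (B * \<bar>t - w j\<bar>)"
    proof (rule vector_differentiable_bound_linearization[where S = "closed_segment (w j) t"])
      show "((\<lambda>t. F p (w(j := t))) has_vector_derivative F' p (w(j := t'))) (at t' within closed_segment (w j) t)"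
        for t'
        using has_partial_at[OF deriv p] by (rule has_vector_derivative_at_within)
      show "norm (F' p (w(j := t')) - F' p (w(j := w j))) \<le> B * \<bar>t - w j\<bar>"
        if "t' \<in> closed_segment (w j) t" for t'
        using B[OF that] .
    qed simp_all
    then show ?thesis
      by (simp add: power2_eq_square algebra_simps flip: abs_mult)
  qed
  \<comment> \<open>The first-order remainder, nested so that each level combines two functions as
    in the linearity clause of \<open>bounded_operator\<close>.\<close>
  define G where "G t = (\<lambda>p. 1 * (1 * F p (w(j := t)) + - 1 * F p w) + - complex_of_real (t - w j) * F' p w)" for t
  have G: "norm (T (\<lambda>p. F p (w(j := t))) q - T (\<lambda>p. F p w) q - (t - w j) *\<^sub>R T (\<lambda>p. F' p w) q)
      \<le> R * (B * (t - w j)\<^sup>2)" for t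
  proof -
    have adm: "admissible N (\<lambda>p. 1 * F p (w(j := t)) + - 1 * F p w)"
      by (rule admissible_lincomb[OF F F])
    have "T (G t) q = 1 * T (\<lambda>p. 1 * F p (w(j := t)) + - 1 * F p w) q + - complex_of_real (t - w j) * T (\<lambda>p. F' p w) q"
      using T adm F'[of w] q unfolding bounded_operator_def G_def by blast
    also have "T (\<lambda>p. 1 * F p (w(j := t)) + - 1 * F p w) q = 1 * T (\<lambda>p. F p (w(j := t))) q + - 1 * T (\<lambda>p. F p w) q"
      using T F[of w] F[of "w(j := t)"] q unfolding bounded_operator_def by blast
    finally have *: "T (G t) q = T (\<lambda>p. F p (w(j := t))) q - T (\<lambda>p. F p w) q - (t - w j) *\<^sub>R T (\<lambda>p. F' p w) q"
      by (simp add: scaleR_conv_of_real algebra_simps)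
    have "admissible N (G t)"
      unfolding G_def by (rule admissible_lincomb[OF adm F'])
    moreover have "norm (G t p) \<le> B * (t - w j)\<^sup>2" if "p \<in> space N" for p
      using quad[OF that, of t] by (simp add: G_def scaleR_conv_of_real algebra_simps)
    ultimately have "norm (T (G t) q) \<le> R * (B * (t - w j)\<^sup>2)"
      using T q unfolding bounded_operator_def admissible_def by blast
    then show ?thesis by (simp add: *)
  qed
  \<comment> \<open>Positive and at least \<open>R * B\<close>, whatever the signs; within radius
    \<open>e / K\<close> the quadratic remainder is then absorbed by the linear tolerance.\<close>
  define K where "K = \<bar>R * B\<bar> + 1"
  have K: "K > 0" by (simp add: K_def add_nonneg_pos)
  show "\<exists>d>0. \<forall>t\<in>UNIV. norm (t - w j) < d \<longrightarrow>
      norm (T (\<lambda>p. F p (w(j := t))) q - T (\<lambda>p. F p (w(j := w j))) q - (t - w j) *\<^sub>R T (\<lambda>p. F' p w) q)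
        \<le> e * norm (t - w j)"
  proof (intro exI[of _ "e / K"] conjI ballI impI)
    show "e / K > 0" using e K by simp
    fix t assume t: "norm (t - w j) < e / K"
    have "R * (B * (t - w j)\<^sup>2) = (R * B) * (\<bar>t - w j\<bar> * \<bar>t - w j\<bar>)"
      by (simp add: power2_eq_square flip: abs_mult)
    also have "\<dots> \<le> K * (\<bar>t - w j\<bar> * \<bar>t - w j\<bar>)"
      by (rule mult_right_mono) (auto simp: K_def)
    also have "\<dots> = (K * \<bar>t - w j\<bar>) * \<bar>t - w j\<bar>"
      by simp
    also have "\<dots> \<le> e * \<bar>t - w j\<bar>"
      using t K by (intro mult_right_mono) (auto simp: field_simps)
    finally show "norm (T (\<lambda>p. F p (w(j := t))) q - T (\<lambda>p. F p (w(j := w j))) q - (t - w j) *\<^sub>R T (\<lambda>p. F' p w) q)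
        \<le> e * norm (t - w j)"
      using G[of t] by simp
  qed
qed

section \<open>Operators and activations acting on jets\<close>

context jets
begin

text \<open>The constant terms of the majorants of \<open>F1\<close> and \<open>F2\<close> bound the
  first derivative. Applied to a derivative, this is the uniform control that
  \<open>has_partial_operator\<close> asks for.\<close>

lemma jet_lipschitz:
  assumes "jet (Suc n) N m M F" "j \<in> I"
  shows "\<exists>B. \<forall>p\<in>space N. \<forall>w t. norm (F p (w(j := t)) - F p w) \<le> B * \<bar>t - w j\<bar>"
proof -
  obtain F1 F2 where F: "has_partial N j F (\<lambda>p w. F1 p w + F2 p w)"
    "jet n N m (fps_const (\<alpha> * real (m j)) * M) F1"
    "jet n N (incr j m) (fps_const (\<beta> j) * fps_deriv M) F2"
    using assms by auto
  define B where "B = (fps_const (\<alpha> * real (m j)) * M) $ 0 + (fps_const (\<beta> j) * fps_deriv M) $ 0"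
  have "meas_bounded N B (\<lambda>p w. F1 p w + F2 p w)"
    unfolding B_def by (intro meas_bounded_add jet_meas_bounded[OF F(2)] jet_meas_bounded[OF F(3)])
  then have B: "norm (F1 p w + F2 p w) \<le> B" if "p \<in> space N" for p w
    using that by (auto simp: meas_bounded_def)
  have "norm (F p (w(j := t)) - F p w) \<le> B * \<bar>t - w j\<bar>" if p: "p \<in> space N" for p w t
  proof -
    have "norm (F p (w(j := t)) - F p (w(j := w j))) \<le> B * norm (t - w j)"
    proof (rule differentiable_bound[where S = UNIV and f = "\<lambda>t. F p (w(j := t))"])
      show "((\<lambda>t. F p (w(j := t))) has_derivative (\<lambda>h. h *\<^sub>R (F1 p (w(j := x)) + F2 p (w(j := x)))))
          (at x within UNIV)" for x
        using has_partial_at[OF F(1) p] by (simp add: has_vector_derivative_def)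
      show "onorm (\<lambda>h. h *\<^sub>R (F1 p (w(j := x)) + F2 p (w(j := x)))) \<le> B" for x
        using B[OF p, of "w(j := x)"] by (intro onorm_le) (simp add: mult.commute[of B] mult_left_mono)
    qed auto
    then show ?thesis by simp
  qed
  then show ?thesis by blast
qed

text \<open>One order is lost, because differentiating under \<open>T\<close> requires a Lipschitz
  derivative and hence one derivative more. This is harmless, since \<open>smooth\<close> provides
  jets of every order.\<close>

lemma jet_operator:
  assumes T: "bounded_operator N N' R T"
  shows "jet (Suc n) N m M F \<Longrightarrow> jet n N' m (fps_const R * M) (\<lambda>q w. T (\<lambda>p. F p w) q)"
proof (induction n arbitrary: m M F)
  case 0
  then show ?case
    using meas_bounded_operator[OF T jet_meas_bounded[OF 0]] by simp
next
  case (Suc n)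
  show ?case
    unfolding jet.simps(2)[of n]
  proof (intro conjI ballI)
    show "meas_bounded N' ((fps_const R * M) $ 0) (\<lambda>q w. T (\<lambda>p. F p w) q)"
      using meas_bounded_operator[OF T jet_meas_bounded[OF Suc.prems]] by simp
    fix j assume j: "j \<in> I"
    obtain F1 F2 where F: "has_partial N j F (\<lambda>p w. F1 p w + F2 p w)"
      "jet (Suc n) N m (fps_const (\<alpha> * real (m j)) * M) F1"
      "jet (Suc n) N (incr j m) (fps_const (\<beta> j) * fps_deriv M) F2"
      using Suc.prems[unfolded jet.simps(2)[of "Suc n"]] j by blast
    obtain B1 B2 where B:
      "\<And>p w t. p \<in> space N \<Longrightarrow> norm (F1 p (w(j := t)) - F1 p w) \<le> B1 * \<bar>t - w j\<bar>"
      "\<And>p w t. p \<in> space N \<Longrightarrow> norm (F2 p (w(j := t)) - F2 p w) \<le> B2 * \<bar>t - w j\<bar>"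
      using jet_lipschitz[OF F(2) j] jet_lipschitz[OF F(3) j] by blast
    have adm: "admissible N (\<lambda>p. F p w)" "admissible N (\<lambda>p. F1 p w)" "admissible N (\<lambda>p. F2 p w)" for w
      using Suc.prems F(2,3) by (auto intro: admissible_meas_bounded jet_meas_bounded)
    have adm12: "admissible N (\<lambda>p. F1 p w + F2 p w)" for w
      using admissible_lincomb[OF adm(2,3), where a = 1 and b = 1] by simp
    have part: "has_partial N' j (\<lambda>q w. T (\<lambda>p. F p w) q) (\<lambda>q w. T (\<lambda>p. F1 p w + F2 p w) q)"
    proof (rule has_partial_operator[OF T adm(1) adm12 F(1)])
      fix p w t assume p: "p \<in> space N"
      have "norm (F1 p (w(j := t)) + F2 p (w(j := t)) - (F1 p w + F2 p w))
          \<le> norm (F1 p (w(j := t)) - F1 p w) + norm (F2 p (w(j := t)) - F2 p w)"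
        by (simp add: norm_triangle_ineq add_diff_add)
      also have "\<dots> \<le> (B1 + B2) * \<bar>t - w j\<bar>"
        using B(1)[OF p, of w t] B(2)[OF p, of w t] by (simp add: distrib_right)
      finally show "norm (F1 p (w(j := t)) + F2 p (w(j := t)) - (F1 p w + F2 p w)) \<le> (B1 + B2) * \<bar>t - w j\<bar>" .
    qed
    have split: "T (\<lambda>p. F1 p w + F2 p w) q = T (\<lambda>p. F1 p w) q + T (\<lambda>p. F2 p w) q"
      if "q \<in> space N'" for q w
    proof -
      have "T (\<lambda>p. 1 * F1 p w + 1 * F2 p w) q = 1 * T (\<lambda>p. F1 p w) q + 1 * T (\<lambda>p. F2 p w) q"
        using T adm(2)[of w] adm(3)[of w] that unfolding bounded_operator_def by blast
      then show ?thesis by simp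
    qed
    have "has_partial N' j (\<lambda>q w. T (\<lambda>p. F p w) q)
        (\<lambda>q w. T (\<lambda>p. F1 p w) q + T (\<lambda>p. F2 p w) q)"
      using has_partial_cong[OF part refl split] .
    moreover have "jet n N' m (fps_const (\<alpha> * real (m j)) * (fps_const R * M)) (\<lambda>q w. T (\<lambda>p. F1 p w) q)"
      using Suc.IH[OF F(2)] by (simp only: mult.left_commute)
    moreover have "jet n N' (incr j m) (fps_const (\<beta> j) * fps_deriv (fps_const R * M)) (\<lambda>q w. T (\<lambda>p. F2 p w) q)"
      using Suc.IH[OF F(3)] by (simp only: mult.left_commute fps_deriv_mult_const_left)
    ultimately show "\<exists>G1 G2. has_partial N' j (\<lambda>q w. T (\<lambda>p. F p w) q) (\<lambda>q w. G1 q w + G2 q w)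
        \<and> jet n N' m (fps_const (\<alpha> * real (m j)) * (fps_const R * M)) G1
        \<and> jet n N' (incr j m) (fps_const (\<beta> j) * fps_deriv (fps_const R * M)) G2"
      by (intro exI[of _ "\<lambda>q w. T (\<lambda>p. F1 p w) q"] exI[of _ "\<lambda>q w. T (\<lambda>p. F2 p w) q"] conjI)
  qed
qed

text \<open>No uniform bound on \<open>F\<close> itself is demanded: hypotheses on \<open>\<sigma>\<close> only concern derivatives of positive
  order. \<open>\<mu>\<close> is the derivative of the majorant of \<open>F\<close>.\<close>

definition smooth :: "'p measure \<Rightarrow> real fps \<Rightarrow> ('p \<Rightarrow> (nat \<Rightarrow> real) \<Rightarrow> complex) \<Rightarrow> bool" where
  "smooth N \<mu> F \<longleftrightarrow> (\<forall>w. (\<lambda>p. F p w) \<in> borel_measurable N)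
     \<and> (\<forall>r. \<exists>B. \<forall>p\<in>space N. \<forall>w. (\<forall>j\<in>I. \<bar>w j\<bar> \<le> r) \<longrightarrow> norm (F p w) \<le> B)
     \<and> (\<forall>n. \<forall>j\<in>I. \<exists>F'. has_partial N j F F' \<and> jet n N (incr j (\<lambda>_. 0)) (fps_const (\<beta> j) * \<mu>) F')"

lemma smooth_admissible:
  assumes "finite I" "smooth N \<mu> F"
  shows "admissible N (\<lambda>p. F p w)"
proof -
  \<comment> \<open>A box that contains the given \<open>w\<close>; its radius is a finite
    sum.\<close>
  have "\<forall>j\<in>I. \<bar>w j\<bar> \<le> (\<Sum>j\<in>I. \<bar>w j\<bar>)"
    using assms(1) by (auto intro: member_le_sum)
  then show ?thesis
    using assms(2) unfolding smooth_def admissible_def by blast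
qed

lemma smooth_operator:
  assumes "finite I" and T: "bounded_operator N N' R T" and F: "smooth N \<mu> F"
  shows "smooth N' (fps_const R * \<mu>) (\<lambda>q w. T (\<lambda>p. F p w) q)"
  unfolding smooth_def
proof (intro conjI allI ballI)
  note adm = smooth_admissible[OF assms(1) F]
  show "T (\<lambda>p. F p w) \<in> borel_measurable N'" for w
    using T adm[of w] unfolding bounded_operator_def by blast
  show "\<exists>B. \<forall>q\<in>space N'. \<forall>w. (\<forall>j\<in>I. \<bar>w j\<bar> \<le> r) \<longrightarrow> norm (T (\<lambda>p. F p w) q) \<le> B" for r
  proof -
    obtain B where B: "\<And>p w. p \<in> space N \<Longrightarrow> \<forall>j\<in>I. \<bar>w j\<bar> \<le> r \<Longrightarrow> norm (F p w) \<le> B"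
      using F unfolding smooth_def by blast
    have "norm (T (\<lambda>p. F p w) q) \<le> R * B" if "q \<in> space N'" "\<forall>j\<in>I. \<bar>w j\<bar> \<le> r" for q w
      using T adm[of w] B[OF _ that(2)] that(1) unfolding bounded_operator_def admissible_def by blast
    then show ?thesis by blast
  qed
  fix n j assume j: "j \<in> I"
  \<comment> \<open>Order \<open>Suc n\<close>, since \<open>jet_operator\<close> consumes
    one.\<close>
  obtain F' where F': "has_partial N j F F'" "jet (Suc n) N (incr j (\<lambda>_. 0)) (fps_const (\<beta> j) * \<mu>) F'"
    using F j unfolding smooth_def by blast
  obtain B where B: "\<And>p w t. p \<in> space N \<Longrightarrow> norm (F' p (w(j := t)) - F' p w) \<le> B * \<bar>t - w j\<bar>"
    using jet_lipschitz[OF F'(2) j] by blast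
  have "has_partial N' j (\<lambda>q w. T (\<lambda>p. F p w) q) (\<lambda>q w. T (\<lambda>p. F' p w) q)"
    using admissible_meas_bounded[OF jet_meas_bounded[OF F'(2)]]
    by (intro has_partial_operator[OF T adm _ F'(1) B])
  moreover have "jet n N' (incr j (\<lambda>_. 0)) (fps_const (\<beta> j) * (fps_const R * \<mu>)) (\<lambda>q w. T (\<lambda>p. F' p w) q)"
    using jet_operator[OF T F'(2)] by (simp only: mult.left_commute)
  ultimately show "\<exists>G'. has_partial N' j (\<lambda>q w. T (\<lambda>p. F p w) q) G' \<and>
      jet n N' (incr j (\<lambda>_. 0)) (fps_const (\<beta> j) * (fps_const R * \<mu>)) G'"
    by (intro exI[of _ "\<lambda>q w. T (\<lambda>p. F' p w) q"] conjI)
qed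

lemma smooth_add_const:
  assumes F: "smooth N \<mu> F" and c: "admissible N c"
  shows "smooth N \<mu> (\<lambda>p w. F p w + c p)"
  unfolding smooth_def
proof (intro conjI allI ballI)
  show "(\<lambda>p. F p w + c p) \<in> borel_measurable N" for w
    using assms by (auto simp: smooth_def admissible_def intro!: borel_measurable_add)
  show "\<exists>B. \<forall>p\<in>space N. \<forall>w. (\<forall>j\<in>I. \<bar>w j\<bar> \<le> r) \<longrightarrow> norm (F p w + c p) \<le> B" for r
  proof -
    obtain B where B: "\<And>p w. p \<in> space N \<Longrightarrow> \<forall>j\<in>I. \<bar>w j\<bar> \<le> r \<Longrightarrow> norm (F p w) \<le> B"
      using F unfolding smooth_def by blast
    obtain C where C: "\<And>p. p \<in> space N \<Longrightarrow> norm (c p) \<le> C"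
      using c unfolding admissible_def by blast
    have "norm (F p w + c p) \<le> B + C" if "p \<in> space N" "\<forall>j\<in>I. \<bar>w j\<bar> \<le> r" for p w
      using B[OF that] C[OF that(1)] by (intro order_trans[OF norm_triangle_ineq] add_mono)
    then show ?thesis by blast
  qed
  fix n j assume "j \<in> I"
  then obtain F' where F': "has_partial N j F F'" "jet n N (incr j (\<lambda>_. 0)) (fps_const (\<beta> j) * \<mu>) F'"
    using F unfolding smooth_def by blast
  from F'(1) have "has_partial N j (\<lambda>p w. F p w + c p) F'"
    by (auto simp: has_partial_def intro!: derivative_eq_intros)
  with F'(2) show "\<exists>F'. has_partial N j (\<lambda>p w. F p w + c p) F' \<and>
      jet n N (incr j (\<lambda>_. 0)) (fps_const (\<beta> j) * \<mu>) F'"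
    by blast
qed

text \<open>The factor \<open>W\<close> makes the induction work: the derivative of the composition with \<open>\<sigma> k\<close> is again
  of this form, and \<open>P k\<close> obeys the same differential equation as the majorant of \<open>\<sigma> k\<close> composed
  with the majorant of \<open>g\<close>.\<close>

lemma jet_complex_act_star:
  assumes \<sigma>: "\<And>k t. (\<sigma> k has_real_derivative \<sigma> (Suc k) t) (at t)"
    and \<sigma>_le: "\<And>k t. k \<ge> 1 \<Longrightarrow> \<bar>\<sigma> k t\<bar> \<le> P k $ 0"
    and P: "\<And>k. k \<ge> 1 \<Longrightarrow> fps_deriv (P k) = P (Suc k) * \<mu>"
    and g: "smooth N \<mu> g"
  shows "k \<ge> 1 \<Longrightarrow> jet n N m M W \<Longrightarrow>
    jet n N m (P k * M) (\<lambda>p w. star (complex_act (\<sigma> k) (g p w)) (W p w))"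
proof (induction n arbitrary: k m M W)
  have cont: "continuous_on UNIV (\<sigma> k)" for k
    using \<sigma> by (meson DERIV_isCont continuous_at_imp_continuous_on)
  have bdd: "meas_bounded N ((P k * M) $ 0) (\<lambda>p w. star (complex_act (\<sigma> k) (g p w)) (W p w))"
    if k: "k \<ge> 1" and W: "meas_bounded N (M $ 0) W" for k M W
    unfolding meas_bounded_def
  proof (intro conjI allI ballI)
    show "(\<lambda>p. star (complex_act (\<sigma> k) (g p w)) (W p w)) \<in> borel_measurable N" for w
      using g W by (intro borel_measurable_star borel_measurable_complex_act[OF cont])
        (auto simp: smooth_def meas_bounded_def)
    fix p w assume "p \<in> space N"
    then have "P k $ 0 * norm (W p w) \<le> P k $ 0 * M $ 0"
      using W \<sigma>_le[OF k, of 0] by (intro mult_left_mono) (auto simp: meas_bounded_def)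
    with norm_star_complex_act_le[of "\<sigma> k" "P k $ 0" "g p w" "W p w", OF \<sigma>_le[OF k]]
    show "norm (star (complex_act (\<sigma> k) (g p w)) (W p w)) \<le> (P k * M) $ 0"
      by simp
  qed
  {
    case 0
    then show ?case using bdd by simp
  next
    case (Suc n)
    show ?case
      unfolding jet.simps(2)[of n]
    proof (intro conjI ballI)
      show "meas_bounded N ((P k * M) $ 0) (\<lambda>p w. star (complex_act (\<sigma> k) (g p w)) (W p w))"
        using bdd Suc.prems by simp
      fix j assume j: "j \<in> I"
      obtain W1 W2 where W: "has_partial N j W (\<lambda>p w. W1 p w + W2 p w)"
        "jet n N m (fps_const (\<alpha> * real (m j)) * M) W1"
        "jet n N (incr j m) (fps_const (\<beta> j) * fps_deriv M) W2"
        using Suc.prems(2) j by auto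
      obtain g' where g': "has_partial N j g g'" "jet n N (incr j (\<lambda>_. 0)) (fps_const (\<beta> j) * \<mu>) g'"
        using g j unfolding smooth_def by blast
      define H1 where "H1 = (\<lambda>p w. star (complex_act (\<sigma> k) (g p w)) (W1 p w))"
      define H2 where "H2 = (\<lambda>p w. star (complex_act (\<sigma> k) (g p w)) (W2 p w)
        + star (complex_act (\<sigma> (Suc k)) (g p w)) (star (g' p w) (W p w)))"
      have "has_partial N j (\<lambda>p w. star (complex_act (\<sigma> k) (g p w)) (W p w)) (\<lambda>p w. H1 p w + H2 p w)"
        by (rule has_partial_cong[OF has_partial_star[OF has_partial_complex_act[OF \<sigma> g'(1)] W(1)]])
          (auto simp: H1_def H2_def star.add_right star_assoc)
      moreover have "jet n N m (fps_const (\<alpha> * real (m j)) * (P k * M)) H1"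
        using Suc.IH[OF Suc.prems(1) W(2)] by (simp add: H1_def mult.left_commute)
      moreover have "jet n N (incr j m) (fps_const (\<beta> j) * fps_deriv (P k * M)) H2"
      proof -
        have incr: "(\<lambda>i. incr j (\<lambda>_. 0) i + m i) = incr j m"
          by auto
        \<comment> \<open>Differentiating \<open>\<sigma> k\<close> yields
          \<open>\<sigma> (Suc k)\<close> and a factor \<open>g'\<close>; the product of
          \<open>g'\<close> and \<open>W\<close> becomes the new factor in the induction
          hypothesis.\<close>
        have "jet n N (incr j m) (fps_const (\<beta> j) * \<mu> * M) (\<lambda>p w. star (g' p w) (W p w))"
          using jet_star[OF g'(2) jet_SucD[OF Suc.prems(2)], unfolded incr] .
        then have "jet n N (incr j m) (P (Suc k) * (fps_const (\<beta> j) * \<mu> * M))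
            (\<lambda>p w. star (complex_act (\<sigma> (Suc k)) (g p w)) (star (g' p w) (W p w)))"
          by (rule Suc.IH[rotated]) simp
        from jet_add[OF Suc.IH[OF Suc.prems(1) W(3)] this] show ?thesis
          by (simp add: H2_def P[OF Suc.prems(1)] algebra_simps)
      qed
      ultimately show "\<exists>H1 H2. has_partial N j (\<lambda>p w. star (complex_act (\<sigma> k) (g p w)) (W p w))
            (\<lambda>p w. H1 p w + H2 p w)
          \<and> jet n N m (fps_const (\<alpha> * real (m j)) * (P k * M)) H1
          \<and> jet n N (incr j m) (fps_const (\<beta> j) * fps_deriv (P k * M)) H2"
        by blast
    qed
  }
qed

lemma smooth_complex_act:
  assumes \<sigma>: "\<And>k t. (\<sigma> k has_real_derivative \<sigma> (Suc k) t) (at t)"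
    and \<sigma>_le: "\<And>k t. k \<ge> 1 \<Longrightarrow> \<bar>\<sigma> k t\<bar> \<le> P k $ 0"
    and P: "\<And>k. k \<ge> 1 \<Longrightarrow> fps_deriv (P k) = P (Suc k) * \<mu>"
    and g: "smooth N \<mu> g"
  shows "smooth N (P 1 * \<mu>) (\<lambda>p w. complex_act (\<sigma> 0) (g p w))"
  unfolding smooth_def
proof (intro conjI allI ballI)
  have cont: "continuous_on A (\<sigma> 0)" for A
    using \<sigma> by (meson DERIV_isCont continuous_at_imp_continuous_on)
  show "(\<lambda>p. complex_act (\<sigma> 0) (g p w)) \<in> borel_measurable N" for w
    using g by (intro borel_measurable_complex_act[OF cont]) (auto simp: smooth_def)
  show "\<exists>B. \<forall>p\<in>space N. \<forall>w. (\<forall>j\<in>I. \<bar>w j\<bar> \<le> r) \<longrightarrow> norm (complex_act (\<sigma> 0) (g p w)) \<le> B" for r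
  proof -
    obtain B where B: "\<And>p w. p \<in> space N \<Longrightarrow> \<forall>j\<in>I. \<bar>w j\<bar> \<le> r \<Longrightarrow> norm (g p w) \<le> B"
      using g unfolding smooth_def by blast
    \<comment> \<open>The activation is bounded only on compact intervals, which matches the local
      bounds of \<open>smooth\<close>.\<close>
    have "bounded (\<sigma> 0 ` {-B..B})"
      by (intro compact_imp_bounded compact_continuous_image cont compact_Icc)
    then have "\<exists>C. \<forall>t\<in>{-B..B}. \<bar>\<sigma> 0 t\<bar> \<le> C"
      by (simp add: bounded_iff)
    then obtain C where C: "\<And>t. t \<in> {-B..B} \<Longrightarrow> \<bar>\<sigma> 0 t\<bar> \<le> C"
      by blast
    have "norm (complex_act (\<sigma> 0) (g p w)) \<le> C + C" if "p \<in> space N" "\<forall>j\<in>I. \<bar>w j\<bar> \<le> r" for p w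
    proof -
      have "\<bar>Re (g p w)\<bar> \<le> B" "\<bar>Im (g p w)\<bar> \<le> B"
        using B[OF that] abs_Re_le_cmod[of "g p w"] abs_Im_le_cmod[of "g p w"] by linarith+
      then have "Re (g p w) \<in> {-B..B}" "Im (g p w) \<in> {-B..B}"
        by auto
      from this[THEN C] have "\<bar>\<sigma> 0 (Re (g p w))\<bar> \<le> C" "\<bar>\<sigma> 0 (Im (g p w))\<bar> \<le> C" .
      then show ?thesis
        using cmod_le[of "complex_act (\<sigma> 0) (g p w)"] by (simp add: complex_act_def)
    qed
    then show ?thesis by blast
  qed
  fix n j assume "j \<in> I"
  then obtain g' where g': "has_partial N j g g'" "jet n N (incr j (\<lambda>_. 0)) (fps_const (\<beta> j) * \<mu>) g'"
    using g unfolding smooth_def by blast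
  \<comment> \<open>The first derivative already has the form treated before, with
    \<open>k = 1\<close> and \<open>W = g'\<close>; from here on only derivatives of \<sigma> of
    positive order occur.\<close>
  have "jet n N (incr j (\<lambda>_. 0)) (P 1 * (fps_const (\<beta> j) * \<mu>))
      (\<lambda>p w. star (complex_act (\<sigma> 1) (g p w)) (g' p w))"
    by (rule jet_complex_act_star[where \<sigma> = \<sigma> and P = P, OF \<sigma> \<sigma>_le P g _ g'(2)]) auto
  moreover have "has_partial N j (\<lambda>p w. complex_act (\<sigma> 0) (g p w))
      (\<lambda>p w. star (complex_act (\<sigma> 1) (g p w)) (g' p w))"
    using has_partial_complex_act[OF \<sigma> g'(1), of 0] by simp
  ultimately show "\<exists>F'. has_partial N j (\<lambda>p w. complex_act (\<sigma> 0) (g p w)) F' \<and>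
      jet n N (incr j (\<lambda>_. 0)) (fps_const (\<beta> j) * (P 1 * \<mu>)) F'"
    by (intro exI[of _ "\<lambda>p w. star (complex_act (\<sigma> 1) (g p w)) (g' p w)"]) (simp only: mult.left_commute)
qed

end

section \<open>Iterated partial derivatives\<close>

text \<open>\<open>jet\<close> and \<open>smooth\<close> assert derivatives existentially, with
  witnesses that may change with the order. A named derivative, equal to all of them by uniqueness,
  links the orders.\<close>

definition two_sided_partial :: "nat \<Rightarrow> ('p \<Rightarrow> (nat \<Rightarrow> real) \<Rightarrow> complex) \<Rightarrow> 'p \<Rightarrow> (nat \<Rightarrow> real) \<Rightarrow> complex" where
  "two_sided_partial j F p w = vector_derivative (\<lambda>t. F p (w(j := t))) (at (w j))"

lemma has_partial_unique:
  assumes "has_partial N j F F'" "p \<in> space N"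
  shows "F' p w = two_sided_partial j F p w"
  using has_partial_at[OF assms, of w "w j"] unfolding two_sided_partial_def by (simp add: vector_derivative_at[symmetric])

lemma has_partial_two_sided_partial:
  assumes "has_partial N j F F'"
  shows "has_partial N j F (two_sided_partial j F)"
  by (rule has_partial_cong[OF assms refl has_partial_unique[OF assms]])

lemma fun_upd_in_param_cube:
  "y \<in> param_cube s \<Longrightarrow> j \<in> {1..s} \<Longrightarrow> t \<in> {0..1} \<Longrightarrow> y(j := t) \<in> param_cube s"
  by (auto simp: param_cube_def PiE_iff extensional_def)

text \<open>A derivative within \<open>{0..1}\<close> sees only values in the cube, so
  \<open>H\<close> may be arbitrary outside. This connects the one-sided derivatives of the theorem
  with the two-sided ones.\<close>

lemma has_vector_derivative_within_cube:
  assumes "has_partial N j K K'" "p \<in> space N" "y \<in> param_cube s" "j \<in> {1..s}"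
    and "\<And>z. z \<in> param_cube s \<Longrightarrow> H z = K p z"
  shows "((\<lambda>t. H (y(j := t))) has_vector_derivative K' p y) (at (y j) within {0..1})"
proof (rule has_vector_derivative_transform[where f = "\<lambda>t. K p (y(j := t))"])
  show "y j \<in> {0..1}"
    using assms(3,4) by (auto simp: param_cube_def PiE_iff)
  show "H (y(j := t)) = K p (y(j := t))" if "t \<in> {0..1}" for t
    using assms(5) fun_upd_in_param_cube[OF assms(3,4) that] by simp
  show "((\<lambda>t. K p (y(j := t))) has_vector_derivative K' p y) (at (y j) within {0..1})"
    using assms(1,2) by (auto simp: has_partial_def intro: has_vector_derivative_at_within)
qed

text \<open>Agreement on the cube survives each differentiation, because a derivative within a
  nondegenerate interval is unique even at the end points.\<close>

lemma foldr_partial_y_eq: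
  assumes "\<And>js j. set js \<subseteq> {1..s} \<Longrightarrow> j \<in> {1..s} \<Longrightarrow>
      has_partial N j (foldr two_sided_partial js F) (foldr two_sided_partial (j # js) F)" and p: "p \<in> space N"
  shows "set js \<subseteq> {1..s} \<Longrightarrow> y \<in> param_cube s \<Longrightarrow> foldr partial_y js (F p) y = foldr two_sided_partial js F p y"
proof (induction js arbitrary: y)
  case (Cons j js)
  have "((\<lambda>t. foldr partial_y js (F p) (y(j := t))) has_vector_derivative foldr two_sided_partial (j # js) F p y)
      (at (y j) within {0..1})"
    using Cons by (intro has_vector_derivative_within_cube[OF assms(1) p]) auto
  moreover have "y j \<in> {0..1}"
    using Cons.prems by (auto simp: param_cube_def PiE_iff)
  ultimately show ?case
    by (simp add: partial_y_def[of j "foldr partial_y js (F p)"] vector_derivative_within_closed_interval)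
qed simp

text \<open>As a list of single differentiations, a mixed partial falls under the same results as
  the arbitrary orders in \<open>has_all_partials\<close>.\<close>

lemma mixed_partial_foldr:
  "mixed_partial s \<nu> F = foldr partial_y (concat (map (\<lambda>j. replicate (\<nu> j) j) [1..<Suc s])) F"
proof -
  have "foldr (\<lambda>j. partial_y j ^^ \<nu> j) js F = foldr partial_y (concat (map (\<lambda>j. replicate (\<nu> j) j) js)) F" for js
  proof (induction js)
    case (Cons j js)
    have "(partial_y j ^^ k) G = foldr partial_y (replicate k j) G" for k G
      by (induction k) auto
    with Cons show ?case by simp
  qed simp
  then show ?thesis by (simp add: mixed_partial_def)
qed

section \<open>Numerical bounds extracted from jets\<close>

context jets
begin

text \<open>The list is read with the innermost derivative first, i.e. reversed with respect to
  \<open>foldr\<close>; the arguments of \<open>list_jet\<close> below follow \<open>foldr\<close>.\<close>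

primrec jet_bound :: "nat list \<Rightarrow> (nat \<Rightarrow> nat) \<Rightarrow> real fps \<Rightarrow> real" where
  "jet_bound [] m M = M $ 0"
| "jet_bound (j # js) m M = \<alpha> * real (m j) * jet_bound js m M
     + jet_bound js (incr j m) (fps_const (\<beta> j) * fps_deriv M)"

lemma jet_bound_const_mult: "jet_bound js m (fps_const c * M) = c * jet_bound js m M"
proof (induction js arbitrary: m M)
  case (Cons j js)
  have "fps_const (\<beta> j) * fps_deriv (fps_const c * M) = fps_const c * (fps_const (\<beta> j) * fps_deriv M)"
    by (simp add: mult.left_commute)
  then show ?case
    by (simp only: jet_bound.simps Cons.IH distrib_left mult.left_commute[of _ c])
qed simp

text \<open>The derivative of a jet is a sum of two jets with different exponents \<open>m\<close>,
  hence not a single jet. Keeping just one number per list of differentiations makes such sums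
  harmless.\<close>

primrec list_jet ::
    "nat \<Rightarrow> 'p measure \<Rightarrow> (nat list \<Rightarrow> real) \<Rightarrow> ('p \<Rightarrow> (nat \<Rightarrow> real) \<Rightarrow> complex) \<Rightarrow> bool"
where
  "list_jet 0 N u F = (\<forall>p\<in>space N. \<forall>w. norm (F p w) \<le> u [])"
| "list_jet (Suc n) N u F = ((\<forall>p\<in>space N. \<forall>w. norm (F p w) \<le> u []) \<and>
     (\<forall>j\<in>I. \<exists>F'. has_partial N j F F' \<and> list_jet n N (\<lambda>js. u (js @ [j])) F'))"

lemma list_jet_norm_le: "list_jet n N u F \<Longrightarrow> p \<in> space N \<Longrightarrow> norm (F p w) \<le> u []"
  by (cases n) auto

lemma list_jet_cong:
  assumes "list_jet n N u F" "\<And>p w. p \<in> space N \<Longrightarrow> F p w = G p w"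
  shows "list_jet n N u G"
proof (cases n)
  case 0
  then show ?thesis using assms by simp
next
  case (Suc k)
  have "has_partial N j F F' \<longleftrightarrow> has_partial N j G F'" for j F'
    using assms(2) by (simp add: has_partial_def)
  then show ?thesis using assms Suc by simp
qed

lemma list_jet_add:
  "list_jet n N u F \<Longrightarrow> list_jet n N v G \<Longrightarrow> list_jet n N (\<lambda>js. u js + v js) (\<lambda>p w. F p w + G p w)"
proof (induction n arbitrary: u F v G)
  case 0
  then show ?case by (auto intro!: order_trans[OF norm_triangle_ineq] add_mono)
next
  case (Suc n)
  show ?case
    unfolding list_jet.simps(2)[of n]
  proof (intro conjI ballI allI)
    show "norm (F p w + G p w) \<le> u [] + v []" if "p \<in> space N" for p w
      using Suc.prems that by (auto intro!: order_trans[OF norm_triangle_ineq] add_mono)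
    fix j assume j: "j \<in> I"
    obtain F' where F': "has_partial N j F F'" "list_jet n N (\<lambda>js. u (js @ [j])) F'"
      using Suc.prems j by auto
    obtain G' where G': "has_partial N j G G'" "list_jet n N (\<lambda>js. v (js @ [j])) G'"
      using Suc.prems j by auto
    show "\<exists>H'. has_partial N j (\<lambda>p w. F p w + G p w) H' \<and> list_jet n N (\<lambda>js. u (js @ [j]) + v (js @ [j])) H'"
      using has_partial_add[OF F'(1) G'(1)] Suc.IH[OF F'(2) G'(2)]
      by (intro exI[of _ "\<lambda>p w. F' p w + G' p w"] conjI)
  qed
qed

lemma jet_imp_list_jet: "jet n N m M F \<Longrightarrow> list_jet n N (\<lambda>js. jet_bound (rev js) m M) F"
proof (induction n arbitrary: m M F)
  case 0
  then show ?case by (simp add: meas_bounded_def)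
next
  case (Suc n)
  show ?case
    unfolding list_jet.simps(2)[of n]
  proof (intro conjI ballI allI)
    show "norm (F p w) \<le> jet_bound (rev []) m M" if "p \<in> space N" for p w
      using Suc.prems that by (simp add: meas_bounded_def)
    fix j assume j: "j \<in> I"
    obtain F1 F2 where F: "has_partial N j F (\<lambda>p w. F1 p w + F2 p w)"
      "jet n N m (fps_const (\<alpha> * real (m j)) * M) F1"
      "jet n N (incr j m) (fps_const (\<beta> j) * fps_deriv M) F2"
      using Suc.prems j by auto
    have "list_jet n N (\<lambda>js. jet_bound (rev (js @ [j])) m M) (\<lambda>p w. F1 p w + F2 p w)"
      using list_jet_add[OF Suc.IH[OF F(2)] Suc.IH[OF F(3)]]
      by (simp only: jet_bound_const_mult rev_append rev.simps append.simps jet_bound.simps)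
    with F(1) show "\<exists>F'. has_partial N j F F' \<and> list_jet n N (\<lambda>js. jet_bound (rev (js @ [j])) m M) F'"
      by (intro exI[of _ "\<lambda>p w. F1 p w + F2 p w"] conjI)
  qed
qed

lemma list_jet_two_sided_partial:
  assumes "list_jet (Suc n) N u F" "j \<in> I"
  shows "has_partial N j F (two_sided_partial j F)" "list_jet n N (\<lambda>js. u (js @ [j])) (two_sided_partial j F)"
proof -
  obtain F' where F': "has_partial N j F F'" "list_jet n N (\<lambda>js. u (js @ [j])) F'"
    using assms by auto
  show "has_partial N j F (two_sided_partial j F)"
    by (rule has_partial_two_sided_partial[OF F'(1)])
  show "list_jet n N (\<lambda>js. u (js @ [j])) (two_sided_partial j F)"
    using list_jet_cong[OF F'(2)] has_partial_unique[OF F'(1)] by blast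
qed

lemma list_jet_foldr_two_sided_partial:
  "list_jet (length js + n) N u F \<Longrightarrow> set js \<subseteq> I \<Longrightarrow> list_jet n N (\<lambda>ks. u (ks @ js)) (foldr two_sided_partial js F)"
proof (induction js arbitrary: n)
  case (Cons j js)
  then have "list_jet (Suc n) N (\<lambda>ks. u (ks @ js)) (foldr two_sided_partial js F)"
    by (intro Cons.IH) auto
  from list_jet_two_sided_partial(2)[OF this, of j] show ?case
    using Cons.prems by simp
qed simp

text \<open>Uniform bounds start with the first derivative. For \<open>m = 0\<close> the bound of a
  nonempty list depends on \<open>fps_deriv M\<close> alone, so the constant term of
  \<open>M\<close> may be chosen freely.\<close>

lemma smooth_list_jet_two_sided_partial:
  assumes F: "smooth N (fps_deriv M) F" and j: "j \<in> I"
  shows "has_partial N j F (two_sided_partial j F)"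
    "list_jet n N (\<lambda>js. jet_bound (rev (js @ [j])) (\<lambda>_. 0) M) (two_sided_partial j F)"
proof -
  obtain F' where F': "has_partial N j F F'" "jet n N (incr j (\<lambda>_. 0)) (fps_const (\<beta> j) * fps_deriv M) F'"
    using F j unfolding smooth_def by blast
  show "has_partial N j F (two_sided_partial j F)"
    by (rule has_partial_two_sided_partial[OF F'(1)])
  have "list_jet n N (\<lambda>js. jet_bound (rev (js @ [j])) (\<lambda>_. 0) M) F'"
    using jet_imp_list_jet[OF F'(2)] by simp
  then show "list_jet n N (\<lambda>js. jet_bound (rev (js @ [j])) (\<lambda>_. 0) M) (two_sided_partial j F)"
    using list_jet_cong has_partial_unique[OF F'(1)] by blast
qed

lemma smooth_foldr_two_sided_partial:
  assumes F: "smooth N (fps_deriv M) F" and js: "set js \<subseteq> I"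
  shows "\<And>j. j \<in> I \<Longrightarrow> has_partial N j (foldr two_sided_partial js F) (foldr two_sided_partial (j # js) F)"
    and "js \<noteq> [] \<Longrightarrow> p \<in> space N \<Longrightarrow> norm (foldr two_sided_partial js F p w) \<le> jet_bound (rev js) (\<lambda>_. 0) M"
proof -
  show "has_partial N j (foldr two_sided_partial js F) (foldr two_sided_partial (j # js) F)" if "j \<in> I" for j
  \<comment> \<open>The last entry is the derivative taken first; splitting it off passes from the
    possibly unbounded \<open>F\<close> to a bounded derivative.\<close>
  proof (cases js rule: rev_cases)
    case Nil
    then show ?thesis using smooth_list_jet_two_sided_partial(1)[OF F that] by simp
  next
    case (snoc ks k)
    then have k: "k \<in> I" "set ks \<subseteq> I" using js by auto
    from list_jet_two_sided_partial(1)[OF list_jet_foldr_two_sided_partial[OF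
        smooth_list_jet_two_sided_partial(2)[OF F k(1)] k(2)] that]
    show ?thesis by (simp add: snoc)
  qed
  show "norm (foldr two_sided_partial js F p w) \<le> jet_bound (rev js) (\<lambda>_. 0) M" if "js \<noteq> []" and p: "p \<in> space N"
  proof (cases js rule: rev_cases)
    case Nil
    then show ?thesis using that by simp
  next
    case (snoc ks k)
    then have k: "k \<in> I" "set ks \<subseteq> I" using js by auto
    from list_jet_norm_le[OF list_jet_foldr_two_sided_partial[OF
        smooth_list_jet_two_sided_partial(2)[OF F k(1)] k(2)] p]
    show ?thesis by (simp add: snoc)
  qed
qed

text \<open>Each differentiation hits either the prefactor, giving \<alpha> times its current
  exponent \<open>i\<close>, or \<open>M\<close>, raising \<open>i\<close> by one. This is the
  recursion S(k+1,i) = i S(k,i) + S(k,i-1) of the Stirling numbers, started at exponent 0.\<close>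

lemma jet_bound_replicate:
  "m j = 0 \<Longrightarrow> jet_bound (replicate k j @ js) m M =
    (\<Sum>i\<le>k. real (Stirling k i) * \<alpha> ^ (k - i) * \<beta> j ^ i * jet_bound js (m(j := i)) (fps_nth_deriv i M))"
proof (induction k arbitrary: js)
  case 0
  then show ?case by (simp add: fun_upd_idem)
next
  case (Suc k)
  define J where "J i = \<beta> j ^ i * jet_bound js (m(j := i)) (fps_nth_deriv i M)" for i
  have step: "\<beta> j ^ i * jet_bound (j # js) (m(j := i)) (fps_nth_deriv i M) = \<alpha> * real i * J i + J (Suc i)" for i
  proof -
    have "fps_deriv (fps_nth_deriv i M) = fps_nth_deriv (Suc i) M"
      by (rule fps_nth_deriv_commute[symmetric])
    then show ?thesis
      by (simp add: J_def jet_bound_const_mult algebra_simps del: fps_nth_deriv.simps)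
  qed
  \<comment> \<open>One \<open>j\<close> moves into the tail, which is why the tail varies in the
    induction.\<close>
  have "jet_bound (replicate (Suc k) j @ js) m M = jet_bound (replicate k j @ j # js) m M"
    by (simp add: replicate_app_Cons_same)
  also have "\<dots> = (\<Sum>i\<le>k. real (Stirling k i) * \<alpha> ^ (k - i) * (\<alpha> * real i * J i + J (Suc i)))"
    using Suc by (simp only: mult.assoc step)
  also have "\<dots> = (\<Sum>i\<le>k. real (i * Stirling k i) * \<alpha> ^ (Suc k - i) * J i)
      + (\<Sum>i\<le>k. real (Stirling k i) * \<alpha> ^ (k - i) * J (Suc i))"
    by (simp add: sum.distrib algebra_simps Suc_diff_le flip: sum.distrib)
  \<comment> \<open>Preparation of an index shift: the added term has
    \<open>Stirling k (Suc k) = 0\<close>, and the term dropped by the shift has the factor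
    \<open>i = 0\<close>.\<close>
  also have "(\<Sum>i\<le>k. real (i * Stirling k i) * \<alpha> ^ (Suc k - i) * J i)
      = (\<Sum>i\<le>Suc k. real (i * Stirling k i) * \<alpha> ^ (Suc k - i) * J i)"
    by simp
  also have "\<dots> = (\<Sum>i\<le>k. real (Suc i * Stirling k (Suc i)) * \<alpha> ^ (k - i) * J (Suc i))"
    by (subst sum.atMost_Suc_shift) simp
  also have "\<dots> + (\<Sum>i\<le>k. real (Stirling k i) * \<alpha> ^ (k - i) * J (Suc i))
      = (\<Sum>i\<le>k. real (Stirling (Suc k) (Suc i)) * \<alpha> ^ (k - i) * J (Suc i))"
    by (simp add: sum.distrib algebra_simps flip: sum.distrib)
  also have "\<dots> = (\<Sum>i\<le>Suc k. real (Stirling (Suc k) i) * \<alpha> ^ (Suc k - i) * J i)"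
    by (subst sum.atMost_Suc_shift) simp
  finally show ?case by (simp only: J_def mult.assoc)
qed

text \<open>Owing to \<open>rev\<close>, the block of the largest index comes first and is removed
  by \<open>jet_bound_replicate\<close>; the derivatives of \<open>M\<close> it produces are passed
  on to the smaller indices and add up to \<open>mi_order s k\<close>.\<close>

lemma jet_bound_mixed:
  assumes "\<And>j. j \<in> {1..s} \<Longrightarrow> m j = 0"
  shows "jet_bound (rev (concat (map (\<lambda>j. replicate (\<nu> j) j) [1..<Suc s]))) m M =
    (\<Sum>k\<in>mi_below s \<nu>. (\<Prod>j=1..s. real (Stirling (\<nu> j) (k j)) * \<alpha> ^ (\<nu> j - k j) * \<beta> j ^ k j)
       * (fact (mi_order s k) * M $ mi_order s k))"
  using assms
proof (induction s arbitrary: m M)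
  case 0
  then show ?case by (simp add: mi_below_def mi_order_def)
next
  case (Suc s)
  let ?js = "\<lambda>s. rev (concat (map (\<lambda>j. replicate (\<nu> j) j) [1..<Suc s]))"
  define f where "f j i = real (Stirling (\<nu> j) i) * \<alpha> ^ (\<nu> j - i) * \<beta> j ^ i" for j i
  \<comment> \<open>The offset \<open>n\<close> counts the derivatives of \<open>M\<close> already
    spent on larger indices.\<close>
  define g where "g s k n = (\<Prod>j=1..s. f j (k j)) * (fact (mi_order s k + n) * M $ (mi_order s k + n))" for s and k :: "nat \<Rightarrow> nat" and n
  have deriv: "fact p * fps_nth_deriv i M $ p = fact (p + i) * M $ (p + i)" for p i
    by (induction i arbitrary: M) (simp_all add: algebra_simps)
  have "jet_bound (?js (Suc s)) m M = jet_bound (replicate (\<nu> (Suc s)) (Suc s) @ ?js s) m M"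
    by simp
  also have "\<dots> = (\<Sum>i\<le>\<nu> (Suc s). f (Suc s) i * jet_bound (?js s) (m(Suc s := i)) (fps_nth_deriv i M))"
    unfolding f_def by (rule jet_bound_replicate) (simp add: Suc.prems)
  also have "\<dots> = (\<Sum>i\<le>\<nu> (Suc s). f (Suc s) i * (\<Sum>k\<in>mi_below s \<nu>. g s k i))"
  proof (intro sum.cong refl arg_cong2[where f = "(*)"])
    fix i
    have "jet_bound (?js s) (m(Suc s := i)) (fps_nth_deriv i M) =
      (\<Sum>k\<in>mi_below s \<nu>. (\<Prod>j=1..s. f j (k j)) * (fact (mi_order s k) * fps_nth_deriv i M $ mi_order s k))"
      using Suc.prems unfolding f_def by (intro Suc.IH) auto
    then show "jet_bound (?js s) (m(Suc s := i)) (fps_nth_deriv i M) = (\<Sum>k\<in>mi_below s \<nu>. g s k i)"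
      by (simp add: g_def deriv)
  qed
  also have "\<dots> = (\<Sum>(i, k)\<in>{0..\<nu> (Suc s)} \<times> mi_below s \<nu>. f (Suc s) i * g s k i)"
    by (simp add: sum_distrib_left sum.cartesian_product atMost_atLeast0)
  also have "\<dots> = (\<Sum>k\<in>mi_below (Suc s) \<nu>. g (Suc s) k 0)"
  proof -
    have Suc_s: "{1..Suc s} = insert (Suc s) {1..s}" by auto
    have eq: "mi_below (Suc s) \<nu> = (\<lambda>(i, k). k(Suc s := i)) ` ({0..\<nu> (Suc s)} \<times> mi_below s \<nu>)"
      unfolding mi_below_def Suc_s by (rule PiE_insert_eq)
    have inj: "inj_on (\<lambda>(i, k). k(Suc s := i)) ({0..\<nu> (Suc s)} \<times> mi_below s \<nu>)"
      unfolding mi_below_def by (rule inj_combinator) simp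
    have "g (Suc s) (k(Suc s := i)) 0 = f (Suc s) i * g s k i" for i k
    proof -
      have "mi_order (Suc s) (k(Suc s := i)) = mi_order s k + i"
        by (simp add: mi_order_def)
      then show ?thesis by (simp add: g_def)
    qed
    then show ?thesis
      unfolding eq sum.reindex[OF inj] by (auto intro!: sum.cong)
  qed
  finally show ?case by (simp only: g_def f_def add_0_right)
qed

end

text \<open>With \<open>\<alpha> = 0\<close> the prefactor is 1, so each entry contributes exactly
  its weight and one derivative of \<open>M\<close>.\<close>

lemma (in jets) jet_bound_affine:
  assumes "\<alpha> = 0"
  shows "jet_bound js m M = prod_list (map \<beta> js) * (fact (length js) * M $ length js)"
proof (induction js arbitrary: m M)
  case (Cons j js)
  show ?case
    by (simp only: jet_bound.simps Cons.IH) (simp add: assms algebra_simps)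
qed simp

section \<open>Geometric majorants and the layers of the network\<close>

text \<open>The series of 1 / (1 - b X). Layer majorants are handled through their derivatives: that
  of c X / (1 - b X) is \<open>fps_const c * geometric_fps b ^ 2\<close>.\<close>

definition geometric_fps :: "real \<Rightarrow> real fps" where
  "geometric_fps b = Abs_fps (\<lambda>n. b ^ n)"

lemma geometric_fps_nth [simp]: "geometric_fps b $ n = b ^ n"
  by (simp add: geometric_fps_def)

lemma geometric_fps_inverse: "(1 - fps_const b * fps_X) * geometric_fps b = 1"
proof (rule fps_ext)
  fix n
  show "((1 - fps_const b * fps_X) * geometric_fps b) $ n = 1 $ n"
    by (cases n) (simp_all add: algebra_simps)
qed

lemma fps_deriv_geometric_fps: "fps_deriv (geometric_fps b) = fps_const b * geometric_fps b ^ 2"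
proof -
  have "fps_deriv ((1 - fps_const b * fps_X) * geometric_fps b) = 0"
    by (simp add: geometric_fps_inverse)
  then have "(1 - fps_const b * fps_X) * fps_deriv (geometric_fps b) = fps_const b * geometric_fps b"
    by (simp add: algebra_simps)
  then have "geometric_fps b * ((1 - fps_const b * fps_X) * fps_deriv (geometric_fps b)) = geometric_fps b * (fps_const b * geometric_fps b)"
    by simp
  then have "((1 - fps_const b * fps_X) * geometric_fps b) * fps_deriv (geometric_fps b) = fps_const b * geometric_fps b ^ 2"
    by (simp only: power2_eq_square mult_ac)
  then show ?thesis by (simp add: geometric_fps_inverse)
qed

text \<open>The \<open>k\<close>-th derivative of \<open>\<xi> / (1 - \<tau> u)\<close>, evaluated at \<open>u = c X / (1 - b X)\<close>, where \<open>B = b + \<tau> c\<close>.\<close>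

definition moebius_deriv :: "real \<Rightarrow> real \<Rightarrow> real \<Rightarrow> real \<Rightarrow> nat \<Rightarrow> real fps" where
  "moebius_deriv \<xi> \<tau> b B k =
     fps_const (\<xi> * \<tau> ^ k * fact k) * ((1 - fps_const b * fps_X) * geometric_fps B) ^ (k + 1)"

lemma moebius_deriv_nth_0: "moebius_deriv \<xi> \<tau> b B k $ 0 = \<xi> * \<tau> ^ k * fact k"
  by (simp add: moebius_deriv_def fps_power_zeroth)

text \<open>For \<open>B = b + \<tau> * c\<close> and u = c X / (1 - b X), the ratio (1 - b X) / (1
  - B X) equals 1 / (1 - \<tau> u), and the other factor is u'.\<close>

lemma moebius_ratio_cancel:
  "((1 - fps_const b * fps_X) * geometric_fps B) ^ 2 * (fps_const c * geometric_fps b ^ 2) = fps_const c * geometric_fps B ^ 2"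
proof -
  have "((1 - fps_const b * fps_X) * geometric_fps B) ^ 2 * (fps_const c * geometric_fps b ^ 2)
      = ((1 - fps_const b * fps_X) * geometric_fps b) ^ 2 * (fps_const c * geometric_fps B ^ 2)"
    by (simp add: power_mult_distrib mult.assoc mult.left_commute)
  then show ?thesis by (simp add: geometric_fps_inverse)
qed

lemma fps_deriv_moebius_ratio:
  "fps_deriv ((1 - fps_const b * fps_X) * geometric_fps B) = fps_const (B - b) * geometric_fps B ^ 2"
proof -
  have "fps_deriv ((1 - fps_const b * fps_X) * geometric_fps B)
      = (1 - fps_const b * fps_X) * (fps_const B * geometric_fps B ^ 2) - fps_const b * geometric_fps B"
    by (simp add: fps_deriv_geometric_fps flip: fps_const_neg)
  \<comment> \<open>A factor 1 is inserted as (1 - B X) / (1 - B X), so that both terms share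
    \<open>geometric_fps B ^ 2\<close>.\<close>
  also have "\<dots> = (1 - fps_const b * fps_X) * (fps_const B * geometric_fps B ^ 2)
      - fps_const b * (((1 - fps_const B * fps_X) * geometric_fps B) * geometric_fps B)"
    by (simp add: geometric_fps_inverse)
  also have "\<dots> = fps_const (B - b) * geometric_fps B ^ 2"
    by (simp add: power2_eq_square algebra_simps flip: fps_const_sub)
  finally show ?thesis .
qed

text \<open>This provides the hypothesis \<open>P\<close> of \<open>smooth_complex_act\<close>. The
  ratio r satisfies r' = \<tau> r^2 u', so differentiating r^(k+1) raises the exponent by one,
  supplies a factor \<tau> and turns k! into (k+1)!.\<close>

lemma fps_deriv_moebius_deriv:
  "fps_deriv (moebius_deriv \<xi> \<tau> b (b + \<tau> * c) k)
    = moebius_deriv \<xi> \<tau> b (b + \<tau> * c) (Suc k) * (fps_const c * geometric_fps b ^ 2)"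
proof -
  define r where "r = (1 - fps_const b * fps_X) * geometric_fps (b + \<tau> * c)"
  have r': "fps_deriv r = fps_const \<tau> * (r ^ 2 * (fps_const c * geometric_fps b ^ 2))"
    unfolding r_def moebius_ratio_cancel fps_deriv_moebius_ratio by (simp add: mult.assoc[symmetric])
  have "fps_deriv (r ^ (k + 1)) = fps_const (real (k + 1)) * r ^ k * fps_deriv r"
    using fps_deriv_power[of r "k + 1"] by (simp only: add_diff_cancel_right' mult_ac)
  also have "\<dots> = fps_const (\<tau> * real (k + 1)) * r ^ (Suc k + 1) * (fps_const c * geometric_fps b ^ 2)"
    by (simp add: r' power2_eq_square mult.assoc mult.left_commute flip: fps_const_mult)
  finally have "fps_deriv (fps_const (\<xi> * \<tau> ^ k * fact k) * r ^ (k + 1))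
      = (fps_const (\<xi> * \<tau> ^ k * fact k) * fps_const (\<tau> * real (k + 1))) * r ^ (Suc k + 1) * (fps_const c * geometric_fps b ^ 2)"
    by (simp only: fps_deriv_mult_const_left mult.assoc)
  also have "fps_const (\<xi> * \<tau> ^ k * fact k) * fps_const (\<tau> * real (k + 1)) = fps_const (\<xi> * \<tau> ^ Suc k * fact (Suc k))"
    by (simp only: fps_const_mult fact_Suc power_Suc of_nat_mult) (simp add: algebra_simps)
  finally show ?thesis
    by (simp only: moebius_deriv_def r_def)
qed

lemma moebius_deriv_1:
  "moebius_deriv \<xi> \<tau> b B 1 * (fps_const c * geometric_fps b ^ 2) = fps_const (\<xi> * \<tau> * c) * geometric_fps B ^ 2"
proof -
  have "moebius_deriv \<xi> \<tau> b B 1 * (fps_const c * geometric_fps b ^ 2)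
      = fps_const (\<xi> * \<tau>) * (((1 - fps_const b * fps_X) * geometric_fps B) ^ 2 * (fps_const c * geometric_fps b ^ 2))"
    by (simp add: moebius_deriv_def mult.assoc numeral_2_eq_2)
  then show ?thesis
    by (simp only: moebius_ratio_cancel) (simp add: mult.assoc[symmetric])
qed

lemma (in jets) smooth_complex_act_geometric:
  assumes \<sigma>: "\<And>k t. (\<sigma> k has_real_derivative \<sigma> (Suc k) t) (at t)"
    and \<sigma>_le: "\<And>k t. k \<ge> 1 \<Longrightarrow> \<bar>\<sigma> k t\<bar> \<le> \<xi> * \<tau> ^ k * fact k"
    and g: "smooth N (fps_const c * geometric_fps b ^ 2) g"
  shows "smooth N (fps_const (\<xi> * \<tau> * c) * geometric_fps (b + \<tau> * c) ^ 2) (\<lambda>p w. complex_act (\<sigma> 0) (g p w))"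
proof -
  have "smooth N (moebius_deriv \<xi> \<tau> b (b + \<tau> * c) 1 * (fps_const c * geometric_fps b ^ 2))
      (\<lambda>p w. complex_act (\<sigma> 0) (g p w))"
    by (rule smooth_complex_act[where \<sigma> = \<sigma> and P = "moebius_deriv \<xi> \<tau> b (b + \<tau> * c)", OF \<sigma> _ _ g])
      (auto simp: moebius_deriv_nth_0 \<sigma>_le fps_deriv_moebius_deriv)
  then show ?thesis by (simp only: moebius_deriv_1)
qed

section \<open>Matrix norms, Fourier coefficients and layers as bounded operators\<close>

lemma mat_inf_norm_ge: "i \<in> {1..m} \<Longrightarrow> (\<Sum>j=1..n. norm (M i j)) \<le> mat_inf_norm m n M"
  unfolding mat_inf_norm_def by (rule Max_ge) auto

lemma mat_inf_norm_nonneg: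
  assumes "m \<ge> 1"
  shows "mat_inf_norm m n M \<ge> 0"
proof -
  have "0 \<le> (\<Sum>j=1..n. norm (M 1 j))"
    by (simp add: sum_nonneg)
  also have "\<dots> \<le> mat_inf_norm m n M"
    using assms by (intro mat_inf_norm_ge) simp
  finally show ?thesis .
qed

lemma mat_inf_norm_cmat: "mat_inf_norm m n (cmat M) = mat_inf_norm m n M"
  by (simp add: mat_inf_norm_def cmat_def)

lemma norm_mat_vec_le:
  assumes "i \<in> {1..m}" "n \<ge> 1" "\<And>j. j \<in> {1..n} \<Longrightarrow> norm (v j) \<le> c"
  shows "norm (mat_vec n M v i) \<le> mat_inf_norm m n M * c"
proof -
  have "norm (v 1) \<le> c"
    using assms(2) by (intro assms(3)) simp
  then have "c \<ge> 0"
    using norm_ge_zero order_trans by blast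
  have "norm (mat_vec n M v i) \<le> (\<Sum>j=1..n. norm (M i j) * c)"
    unfolding mat_vec_def using assms(3)
    by (intro sum_norm_le) (simp add: norm_mult mult_left_mono)
  also have "\<dots> \<le> mat_inf_norm m n M * c"
    unfolding sum_distrib_right[symmetric]
    using mat_inf_norm_ge[OF assms(1)] \<open>c \<ge> 0\<close> by (rule mult_right_mono)
  finally show ?thesis .
qed

lemma mat_vec_lincomb:
  "mat_vec n M (\<lambda>j. a * u j + b * v j) i = a * mat_vec n M u i + b * mat_vec n M v i"
  by (simp add: mat_vec_def sum.distrib sum_distrib_left algebra_simps)

abbreviation (input) cube_measure :: "(real ^ 'd::finite) measure" where
  "cube_measure \<equiv> lebesgue_on (cbox 0 1)"

text \<open>A vector field becomes one scalar function of component and position. A pointwise bound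
  on this space is at once a vector \<infinity>-norm bound and a bound over the domain, which is how
  matrix \<infinity>-norms become operator bounds.\<close>

abbreviation (input) layer_measure :: "nat \<Rightarrow> (nat \<times> (real ^ 'd::finite)) measure" where
  "layer_measure d \<equiv> count_space {1..d} \<Otimes>\<^sub>M cube_measure"

lemma space_layer_measure: "space (layer_measure d) = {1..d} \<times> cbox 0 1"
  by (simp add: space_pair_measure)

lemma borel_measurable_layer_measure_iff:
  "f \<in> borel_measurable (layer_measure d) \<longleftrightarrow> (\<forall>i\<in>{1..d}. (\<lambda>x. f (i, x)) \<in> borel_measurable cube_measure)"
proof
  assume f: "f \<in> borel_measurable (layer_measure d)"
  show "\<forall>i\<in>{1..d}. (\<lambda>x. f (i, x)) \<in> borel_measurable cube_measure"
    using measurable_compose[OF measurable_Pair1' f] by auto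
next
  assume "\<forall>i\<in>{1..d}. (\<lambda>x. f (i, x)) \<in> borel_measurable cube_measure"
  then show "f \<in> borel_measurable (layer_measure d)"
    by (intro measurable_pair_measure_countable1) auto
qed

lemma measure_cube_measure: "measure (cube_measure :: (real ^ 'd::finite) measure) (cbox 0 1) = 1"
proof -
  have "measure (cube_measure :: (real ^ 'd) measure) (cbox 0 1) = measure lborel (cbox (0::real^'d) 1)"
    by (simp add: measure_restrict_space)
  also have "\<dots> = 1"
    by (simp add: content_cbox_if_cart interval_ne_empty_cart)
  finally show ?thesis .
qed

lemma finite_measure_cube_measure: "finite_measure (cube_measure :: (real ^ 'd::finite) measure)"
  by (rule finite_measure_lebesgue_on) simp

lemma continuous_freq_dot: "continuous_on A (freq_dot h)"
  unfolding freq_dot_def by (intro continuous_intros)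

lemma borel_measurable_cube_exp:
  "(\<lambda>x. exp (c * complex_of_real (freq_dot h x))) \<in> borel_measurable cube_measure"
proof (rule continuous_imp_measurable_on_sets_lebesgue)
  show "continuous_on (cbox 0 1) (\<lambda>x. exp (c * complex_of_real (freq_dot h x)))"
    by (intro continuous_on_exp continuous_on_mult continuous_on_const continuous_on_of_real continuous_freq_dot)
qed simp

text \<open>The exponential has modulus 1 and the cube has volume 1, so a Fourier coefficient costs
  no constant.\<close>

lemma
  fixes v :: "real ^ 'd::finite \<Rightarrow> complex"
  assumes v: "v \<in> borel_measurable cube_measure" and c: "\<And>x. x \<in> cbox 0 1 \<Longrightarrow> norm (v x) \<le> c"
  shows integrable_fourier:
      "integrable cube_measure (\<lambda>x. v x * exp (- (2 * pi * \<i> * complex_of_real (freq_dot h x))))"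
    and norm_fourier_coeff_le: "norm (fourier_coeff v h) \<le> c"
proof -
  let ?f = "\<lambda>x. v x * exp (- (2 * pi * \<i> * complex_of_real (freq_dot h x)))"
  have norm: "norm (?f x) = norm (v x)" for x
    by (simp add: norm_mult)
  have meas: "?f \<in> borel_measurable cube_measure"
    using borel_measurable_times[OF v borel_measurable_cube_exp[of "- (2 * pi * \<i>)" h]] by simp
  show int: "integrable cube_measure ?f"
    by (rule finite_measure.integrable_const_bound[OF finite_measure_cube_measure _ meas, where B = c])
      (auto intro!: AE_I2 simp only: norm c space_lebesgue_on)
  have "norm (fourier_coeff v h) \<le> (LINT x|cube_measure. norm (?f x))"
    unfolding fourier_coeff_def by (rule integral_norm_bound)
  also have "\<dots> \<le> (LINT x|(cube_measure :: (real ^ 'd) measure). c)"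
    using c by (intro integral_mono integrable_norm[OF int] finite_measure.integrable_const[OF finite_measure_cube_measure])
      (simp only: norm space_lebesgue_on)
  also have "\<dots> = c"
    by (simp add: measure_cube_measure)
  finally show "norm (fourier_coeff v h) \<le> c" .
qed

lemma fourier_coeff_lincomb:
  assumes "u \<in> borel_measurable cube_measure" "\<And>x. x \<in> cbox 0 1 \<Longrightarrow> norm (u x) \<le> c"
    and "v \<in> borel_measurable cube_measure" "\<And>x. x \<in> cbox 0 1 \<Longrightarrow> norm (v x) \<le> d"
  shows "fourier_coeff (\<lambda>x. a * u x + b * v x) h = a * fourier_coeff u h + b * fourier_coeff v h"
  using integrable_fourier[OF assms(1,2), where h = h] integrable_fourier[OF assms(3,4), where h = h]
  by (simp add: fourier_coeff_def distrib_right mult.assoc)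

lemma bounded_operator_mat_vec:
  assumes "n \<ge> 1"
  shows "bounded_operator (layer_measure n) (layer_measure m) (mat_inf_norm m n M)
    (\<lambda>u (i, x :: real ^ 'd::finite). mat_vec n M (\<lambda>j. u (j, x)) i)"
  unfolding bounded_operator_def
proof (intro conjI allI impI ballI)
  fix u :: "nat \<times> (real ^ 'd) \<Rightarrow> complex" assume "admissible (layer_measure n) u"
  then have "(\<lambda>x. u (j, x)) \<in> borel_measurable cube_measure" if "j \<in> {1..n}" for j
    using that unfolding admissible_def borel_measurable_layer_measure_iff by blast
  then show "(\<lambda>(i, x). mat_vec n M (\<lambda>j. u (j, x)) i) \<in> borel_measurable (layer_measure m)"
    unfolding borel_measurable_layer_measure_iff mat_vec_def prod.case
    by (intro ballI borel_measurable_sum borel_measurable_times borel_measurable_const)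
next
  fix u v :: "nat \<times> (real ^ 'd) \<Rightarrow> complex" and a b q
  show "(case q of (i, x) \<Rightarrow> mat_vec n M (\<lambda>j. a * u (j, x) + b * v (j, x)) i) =
      a * (case q of (i, x) \<Rightarrow> mat_vec n M (\<lambda>j. u (j, x)) i) + b * (case q of (i, x) \<Rightarrow> mat_vec n M (\<lambda>j. v (j, x)) i)"
    by (cases q) (simp add: mat_vec_lincomb)
next
  fix u :: "nat \<times> (real ^ 'd) \<Rightarrow> complex" and c q
  assume "\<forall>p\<in>space (layer_measure n). norm (u p) \<le> c" and "q \<in> space (layer_measure m :: (nat \<times> (real ^ 'd)) measure)"
  then show "norm (case q of (i, x) \<Rightarrow> mat_vec n M (\<lambda>j. u (j, x)) i) \<le> mat_inf_norm m n M * c"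
    using assms unfolding space_layer_measure
    by (auto simp del: One_nat_def atLeastAtMost_iff intro!: norm_mat_vec_le)
qed

text \<open>The linear part of a layer; the bias does not depend on the parameters and is added
  later by \<open>smooth_add_const\<close>.\<close>

lemma bounded_operator_fno_layer:
  fixes \<theta> :: "'d::finite fno_params"
  assumes n: "width \<theta> l \<ge> 1" and fin: "finite (freqs \<theta>)"
    and R: "mat_inf_norm m (width \<theta> l) (weight \<theta> l)
      + (\<Sum>h\<in>freqs \<theta>. mat_inf_norm m (width \<theta> l) (kernel_hat \<theta> l h)) \<le> R"
  shows "bounded_operator (layer_measure (width \<theta> l)) (layer_measure m) R
    (\<lambda>u (i, x). mat_vec (width \<theta> l) (cmat (weight \<theta> l)) (\<lambda>j. u (j, x)) i + kernel_op \<theta> l (\<lambda>x j. u (j, x)) x i)"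
    (is "bounded_operator _ _ _ ?T")
  unfolding bounded_operator_def
proof (intro conjI allI impI ballI)
  let ?n = "width \<theta> l"
  fix u :: "nat \<times> (real ^ 'd) \<Rightarrow> complex" assume "admissible (layer_measure ?n) u"
  then have "(\<lambda>x. u (j, x)) \<in> borel_measurable cube_measure" if "j \<in> {1..?n}" for j
    using that unfolding admissible_def borel_measurable_layer_measure_iff by blast
  then show "?T u \<in> borel_measurable (layer_measure m)"
    unfolding borel_measurable_layer_measure_iff mat_vec_def kernel_op_def prod.case
    by (intro ballI borel_measurable_add borel_measurable_sum borel_measurable_times
        borel_measurable_const borel_measurable_cube_exp)
next
  let ?n = "width \<theta> l"
  fix u v :: "nat \<times> (real ^ 'd) \<Rightarrow> complex" and a b :: complex and q
  assume u: "admissible (layer_measure ?n) u" and v: "admissible (layer_measure ?n) v"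
    and q: "q \<in> space (layer_measure m :: (nat \<times> (real ^ 'd)) measure)"
  have fc: "fourier_coeff (\<lambda>x. a * u (j, x) + b * v (j, x)) h
      = a * fourier_coeff (\<lambda>x. u (j, x)) h + b * fourier_coeff (\<lambda>x. v (j, x)) h" if j: "j \<in> {1..?n}" for j h
  proof -
    have in_space: "(j, x) \<in> space (layer_measure ?n)" if "x \<in> cbox 0 1" for x :: "real ^ 'd"
      unfolding space_layer_measure using j that by (rule SigmaI)
    obtain c where c: "\<forall>p\<in>space (layer_measure ?n). norm (u p) \<le> c"
      using u unfolding admissible_def by blast
    obtain d where d: "\<forall>p\<in>space (layer_measure ?n). norm (v p) \<le> d"
      using v unfolding admissible_def by blast
    have "(\<lambda>x. u (j, x)) \<in> borel_measurable cube_measure" "(\<lambda>x. v (j, x)) \<in> borel_measurable cube_measure"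
      using u v j unfolding admissible_def borel_measurable_layer_measure_iff by blast+
    then show ?thesis
      using bspec[OF c in_space] bspec[OF d in_space] by (intro fourier_coeff_lincomb)
  qed
  have mv: "mat_vec ?n M (\<lambda>j. fourier_coeff (\<lambda>x. a * u (j, x) + b * v (j, x)) h) i
      = a * mat_vec ?n M (\<lambda>j. fourier_coeff (\<lambda>x. u (j, x)) h) i + b * mat_vec ?n M (\<lambda>j. fourier_coeff (\<lambda>x. v (j, x)) h) i" for M h i
  proof -
    have "mat_vec ?n M (\<lambda>j. fourier_coeff (\<lambda>x. a * u (j, x) + b * v (j, x)) h) i
        = mat_vec ?n M (\<lambda>j. a * fourier_coeff (\<lambda>x. u (j, x)) h + b * fourier_coeff (\<lambda>x. v (j, x)) h) i"
      unfolding mat_vec_def by (intro sum.cong refl) (simp only: fc)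
    then show ?thesis by (simp only: mat_vec_lincomb)
  qed
  have "kernel_op \<theta> l (\<lambda>x j. a * u (j, x) + b * v (j, x)) x i
      = a * kernel_op \<theta> l (\<lambda>x j. u (j, x)) x i + b * kernel_op \<theta> l (\<lambda>x j. v (j, x)) x i" for x i
    by (simp add: kernel_op_def mv sum.distrib sum_distrib_left algebra_simps)
  then show "?T (\<lambda>p. a * u p + b * v p) q = a * ?T u q + b * ?T v q"
    by (cases q) (simp add: mat_vec_lincomb algebra_simps)
next
  let ?n = "width \<theta> l"
  fix u :: "nat \<times> (real ^ 'd) \<Rightarrow> complex" and c q
  assume u: "u \<in> borel_measurable (layer_measure ?n)" "\<forall>p\<in>space (layer_measure ?n). norm (u p) \<le> c"
    and q: "q \<in> space (layer_measure m :: (nat \<times> (real ^ 'd)) measure)"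
  obtain i x where ix: "q = (i, x)" "i \<in> {1..m}" "x \<in> cbox 0 1"
    using q unfolding space_layer_measure by blast
  have c: "norm (u (j, y)) \<le> c" if "j \<in> {1..?n}" "y \<in> cbox 0 1" for j y
    using u(2) that unfolding space_layer_measure by (metis SigmaI)
  have "norm (u (1, x)) \<le> c"
    using n ix by (intro c) auto
  then have c0: "c \<ge> 0"
    using norm_ge_zero order_trans by blast
  have fc: "norm (fourier_coeff (\<lambda>x. u (j, x)) h) \<le> c" if "j \<in> {1..?n}" for j h
  proof (rule norm_fourier_coeff_le[OF _ c[OF that]])
    show "(\<lambda>x. u (j, x)) \<in> borel_measurable cube_measure"
      using u(1) that unfolding borel_measurable_layer_measure_iff by blast
  qed
  have "norm (kernel_op \<theta> l (\<lambda>x j. u (j, x)) x i) \<le> (\<Sum>h\<in>freqs \<theta>. mat_inf_norm m ?n (kernel_hat \<theta> l h) * c)"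
    unfolding kernel_op_def using norm_mat_vec_le[OF ix(2) n fc]
    by (intro sum_norm_le) (simp add: norm_mult)
  moreover have "norm (mat_vec ?n (cmat (weight \<theta> l)) (\<lambda>j. u (j, x)) i) \<le> mat_inf_norm m ?n (weight \<theta> l) * c"
    using norm_mat_vec_le[OF ix(2) n c[OF _ ix(3)], where M = "cmat (weight \<theta> l)"] by (simp only: mat_inf_norm_cmat)
  ultimately have "norm (?T u q) \<le> (mat_inf_norm m ?n (weight \<theta> l) + (\<Sum>h\<in>freqs \<theta>. mat_inf_norm m ?n (kernel_hat \<theta> l h))) * c"
    unfolding ix(1) prod.case distrib_right sum_distrib_right
    by (intro order_trans[OF norm_triangle_ineq] add_mono)
  also have "\<dots> \<le> R * c"
    using R c0 by (rule mult_right_mono)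
  finally show "norm (?T u q) \<le> R * c" .
qed

section \<open>The input fields\<close>

lemma sup_norm_le_ennrealD:
  assumes "sup_norm S f \<le> ennreal c" "x \<in> S" "c \<ge> 0"
  shows "norm (f x) \<le> c"
proof -
  have "ennreal (norm (f x)) \<le> ennreal c"
    using assms(1,2) unfolding sup_norm_def by (metis SUP_upper order_trans)
  then show ?thesis using assms(3) by simp
qed

lemma vec_inf_norm_le_iff: "n \<ge> 1 \<Longrightarrow> vec_inf_norm n v \<le> c \<longleftrightarrow> (\<forall>i\<in>{1..n}. norm (v i) \<le> c)"
  unfolding vec_inf_norm_def by (subst Max_le_iff) auto

lemma field_norm_leI:
  fixes G :: "real ^ 'd::finite \<Rightarrow> (nat \<Rightarrow> real) \<Rightarrow> nat \<Rightarrow> complex"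
  assumes "n \<ge> 1"
    and "\<And>x y i. x \<in> cbox 0 1 \<Longrightarrow> y \<in> param_cube s \<Longrightarrow> i \<in> {1..n} \<Longrightarrow> norm (G x y i) \<le> c"
  shows "field_norm n s G \<le> ennreal c"
  unfolding field_norm_def using assms by (intro SUP_least ennreal_leI) (simp add: vec_inf_norm_le_iff)

section \<open>Jets of the input fields and induction over the layers\<close>

context jets
begin

lemma jet_0: "jet n N m 0 (\<lambda>_ _. 0)"
proof (induction n arbitrary: m)
  case 0
  then show ?case by (simp add: meas_bounded_def)
next
  case (Suc n)
  have "has_partial N j (\<lambda>_ _. 0) (\<lambda>_ _. 0 + 0)" for j
    by (simp add: has_partial_def)
  with Suc show ?case
    unfolding jet.simps(2)[of n]
    by (intro conjI ballI exI[of _ "\<lambda>_ _. 0"]) (auto simp: meas_bounded_def)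
qed

lemma jet_const:
  assumes "\<alpha> = 0" "c \<in> borel_measurable N" "\<And>p. p \<in> space N \<Longrightarrow> norm (c p) \<le> K"
  shows "jet n N m (fps_const K) (\<lambda>p _. c p)"
proof -
  have bdd: "meas_bounded N (fps_const K $ 0) (\<lambda>p _. c p)"
    using assms by (simp add: meas_bounded_def)
  show ?thesis
  proof (cases n)
    case (Suc k)
    have "has_partial N j (\<lambda>p _. c p) (\<lambda>_ _. 0 + 0)" for j
      by (simp add: has_partial_def)
    moreover have zero: "fps_const (\<alpha> * real (m j)) * fps_const K = 0"
      "fps_const (\<beta> j) * fps_deriv (fps_const K) = 0" for j
      by (simp_all add: assms(1))
    ultimately show ?thesis
      using bdd unfolding Suc jet.simps(2)[of k] zero
      by (intro conjI ballI exI[of _ "\<lambda>_ _. 0"] jet_0)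
  qed (use bdd in simp)
qed

text \<open>Each derivative in \<open>w j\<close> multiplies by 2 pi and shifts the phase by pi / 2,
  so phase and amplitude vary in the induction. The factor 2 pi is exactly that of differentiating
  the prefactor; the majorant series itself stays constant.\<close>

lemma jet_sin:
  assumes \<alpha>: "\<alpha> = 2 * pi"
  shows "c \<in> borel_measurable N \<Longrightarrow> (\<And>p. p \<in> space N \<Longrightarrow> norm (c p) \<le> K) \<Longrightarrow>
    jet n N (incr j (\<lambda>_. 0)) (fps_const K) (\<lambda>p w. complex_of_real (sin (2 * pi * w j + \<phi>)) * c p)"
proof (induction n arbitrary: c K \<phi>)
  have bdd: "meas_bounded N (fps_const K $ 0) (\<lambda>p w. complex_of_real (sin (2 * pi * w j + \<phi>)) * c p)"
    if "c \<in> borel_measurable N" "\<And>p. p \<in> space N \<Longrightarrow> norm (c p) \<le> K" for c K \<phi>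
    unfolding meas_bounded_def
  proof (intro conjI allI ballI)
    show "(\<lambda>p. complex_of_real (sin (2 * pi * w j + \<phi>)) * c p) \<in> borel_measurable N" for w :: "nat \<Rightarrow> real"
      using that(1) by (intro borel_measurable_times borel_measurable_const)
    fix p w assume "p \<in> space N"
    then have "\<bar>sin (2 * pi * w j + \<phi>)\<bar> * norm (c p) \<le> 1 * K"
      using that(2) by (intro mult_mono) auto
    then show "norm (complex_of_real (sin (2 * pi * w j + \<phi>)) * c p) \<le> fps_const K $ 0"
      by (simp add: norm_mult)
  qed
  {
    case 0
    then show ?case using bdd by simp
  next
    case (Suc n)
    define F where "F = (\<lambda>p (w :: nat \<Rightarrow> real). complex_of_real (sin (2 * pi * w j + \<phi>)) * c p)"
    define F' where "F' = (\<lambda>p (w :: nat \<Rightarrow> real).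
      complex_of_real (sin (2 * pi * w j + (\<phi> + pi / 2))) * (complex_of_real (2 * pi) * c p))"
    have "jet (Suc n) N (incr j (\<lambda>_. 0)) (fps_const K) F"
      unfolding jet.simps(2)[of n]
    proof (intro conjI ballI)
      show "meas_bounded N (fps_const K $ 0) F"
        unfolding F_def by (rule bdd[OF Suc.prems])
      fix i assume "i \<in> I"
      have F2: "jet n N (incr i (incr j (\<lambda>_. 0))) (fps_const (\<beta> i) * fps_deriv (fps_const K)) (\<lambda>_ _. 0)"
        using jet_0[of n N "incr i (incr j (\<lambda>_. 0))"] by simp
      show "\<exists>F1 F2. has_partial N i F (\<lambda>p w. F1 p w + F2 p w)
          \<and> jet n N (incr j (\<lambda>_. 0)) (fps_const (\<alpha> * real (incr j (\<lambda>_. 0) i)) * fps_const K) F1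
          \<and> jet n N (incr i (incr j (\<lambda>_. 0))) (fps_const (\<beta> i) * fps_deriv (fps_const K)) F2"
      proof (cases "i = j")
        case True
        have "has_partial N i F (\<lambda>p w. F' p w + 0)"
          unfolding has_partial_def
        proof (intro ballI allI)
          fix p w
          have "((\<lambda>t. sin (2 * pi * t + \<phi>)) has_real_derivative 2 * pi * cos (2 * pi * w j + \<phi>)) (at (w j))"
            by (auto intro!: derivative_eq_intros)
          then have "((\<lambda>t. complex_of_real (sin (2 * pi * t + \<phi>)) * c p) has_vector_derivative
              complex_of_real (2 * pi * cos (2 * pi * w j + \<phi>)) * c p) (at (w j))"
            by (intro has_vector_derivative_mult_left has_vector_derivative_of_real)
              (simp add: has_real_derivative_iff_has_vector_derivative)
          moreover have "sin (2 * pi * w j + (\<phi> + pi / 2)) = cos (2 * pi * w j + \<phi>)"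
            using sin_add[of "2 * pi * w j + \<phi>" "pi / 2"] by (simp add: add.assoc)
          ultimately show "((\<lambda>t. F p (w(i := t))) has_vector_derivative F' p w + 0) (at (w i))"
            by (simp add: True F_def F'_def mult_ac)
        qed
        moreover have "jet n N (incr j (\<lambda>_. 0)) (fps_const (2 * pi * K)) F'"
          unfolding F'_def using Suc.prems
          by (intro Suc.IH borel_measurable_times borel_measurable_const) (auto simp: norm_mult)
        ultimately show ?thesis
          using F2 by (intro exI[of _ F'] exI[of _ "\<lambda>_ _. 0"] conjI) (simp_all add: True \<alpha>)
      next
        case False
        have "has_partial N i F (\<lambda>_ _. 0 + 0)"
          using False by (simp add: has_partial_def F_def)
        moreover have "jet n N (incr j (\<lambda>_. 0)) (fps_const (\<alpha> * real (incr j (\<lambda>_. 0) i)) * fps_const K) (\<lambda>_ _. 0)"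
          using False jet_0[of n N "incr j (\<lambda>_. 0)"] by simp
        ultimately show ?thesis
          using F2 by (intro exI[of _ "\<lambda>_ _. 0"] conjI)
      qed
    qed
    then show ?case by (simp only: F_def)
  }
qed

text \<open>The series 1 is the derivative of the majorant t of the lifted input. The function
  \<open>\<phi>\<close> covers both fields.\<close>

lemma smooth_lift:
  fixes \<psi> :: "nat \<Rightarrow> real ^ 'd::finite \<Rightarrow> complex"
  assumes I: "I = {1..s}"
    and meas: "\<And>j. j \<le> s \<Longrightarrow> \<psi> j \<in> borel_measurable cube_measure"
    and bdd: "\<And>j. j \<le> s \<Longrightarrow> bounded (\<psi> j ` cbox 0 1)"
    and \<phi>: "\<And>t. (\<phi> has_real_derivative \<phi>' t) (at t)"
    and a: "a = (\<lambda>x y. \<psi> 0 x + (\<Sum>j=1..s. complex_of_real (\<phi> (y j)) * \<psi> j x))"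
    and jets: "\<And>n j. j \<in> {1..s} \<Longrightarrow> jet n (layer_measure d) (incr j (\<lambda>_. 0)) (fps_const (\<beta> j))
      (\<lambda>p w. complex_of_real (\<phi>' (w j)) * (P (fst p) 1 * \<psi> j (snd p)))"
  shows "smooth (layer_measure d) 1 (\<lambda>p w. mat_vec 1 P (\<lambda>_. a (snd p) w) (fst p))"
  unfolding smooth_def
proof (intro conjI allI ballI)
  have lift: "mat_vec 1 P (\<lambda>_. a (snd p) w) (fst p) = P (fst p) 1 * a (snd p) w" for p w
    by (simp add: mat_vec_def)
  have "(\<lambda>x. a x w) \<in> borel_measurable cube_measure" for w
    unfolding a by (intro borel_measurable_add borel_measurable_sum borel_measurable_times borel_measurable_const meas) auto
  then show "(\<lambda>p. mat_vec 1 P (\<lambda>_. a (snd p) w) (fst p)) \<in> borel_measurable (layer_measure d)" for w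
    unfolding lift borel_measurable_layer_measure_iff fst_conv snd_conv
    by (intro ballI borel_measurable_times borel_measurable_const)
  show "\<exists>B. \<forall>p\<in>space (layer_measure d). \<forall>w. (\<forall>j\<in>I. \<bar>w j\<bar> \<le> r) \<longrightarrow>
      norm (mat_vec 1 P (\<lambda>_. a (snd p) w) (fst p)) \<le> B" for r
  proof -
    have "\<forall>j\<in>{..s}. \<exists>B. \<forall>x\<in>cbox 0 1. norm (\<psi> j x) \<le> B"
      using bdd by (auto simp: bounded_iff)
    from bchoice[OF this] obtain B where "\<forall>j\<in>{..s}. \<forall>x\<in>cbox 0 1. norm (\<psi> j x) \<le> B j"
      by blast
    then have B: "\<And>j x. j \<le> s \<Longrightarrow> x \<in> cbox 0 1 \<Longrightarrow> norm (\<psi> j x) \<le> B j"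
      by simp
    have "continuous_on {-r..r} \<phi>"
      using \<phi> by (meson DERIV_isCont continuous_at_imp_continuous_on)
    then have "bounded (\<phi> ` {-r..r})"
      by (intro compact_imp_bounded compact_continuous_image compact_Icc)
    then obtain C where C: "\<forall>t\<in>{-r..r}. \<bar>\<phi> t\<bar> \<le> C"
      by (auto simp: bounded_iff)
    define A where "A = B 0 + (\<Sum>j=1..s. C * B j)"
    have A: "norm (a x w) \<le> A" if x: "x \<in> cbox 0 1" and w: "\<forall>j\<in>I. \<bar>w j\<bar> \<le> r" for x w
      unfolding a A_def
    proof (intro order_trans[OF norm_triangle_ineq] add_mono sum_norm_le B x)
      fix j assume j: "j \<in> {1..s}"
      have "w j \<in> {-r..r}"
        using w j I by (auto simp: abs_le_iff minus_le_iff)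
      then have "\<bar>\<phi> (w j)\<bar> \<le> C" using C by blast
      moreover have "norm (\<psi> j x) \<le> B j" using j x B by simp
      ultimately have "\<bar>\<phi> (w j)\<bar> * norm (\<psi> j x) \<le> C * B j"
        by (intro mult_mono') auto
      then show "norm (complex_of_real (\<phi> (w j)) * \<psi> j x) \<le> C * B j"
        by (simp add: norm_mult)
    qed simp
    have "norm (mat_vec 1 P (\<lambda>_. a (snd p) w) (fst p)) \<le> (\<Sum>i\<in>{1..d}. norm (P i 1)) * A"
      if p: "p \<in> space (layer_measure d)" and w: "\<forall>j\<in>I. \<bar>w j\<bar> \<le> r" for p w
      unfolding lift norm_mult
    proof (rule mult_mono')
      from p have p': "fst p \<in> {1..d}" "snd p \<in> cbox 0 1"
        unfolding space_layer_measure by auto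
      from p'(1) show "norm (P (fst p) 1) \<le> (\<Sum>i\<in>{1..d}. norm (P i 1))"
        by (intro member_le_sum) auto
      show "norm (a (snd p) w) \<le> A"
        by (rule A[OF p'(2) w])
    qed auto
    then show ?thesis by blast
  qed
  fix n j assume j: "j \<in> I"
  have "has_partial (layer_measure d) j (\<lambda>p w. mat_vec 1 P (\<lambda>_. a (snd p) w) (fst p))
      (\<lambda>p w. complex_of_real (\<phi>' (w j)) * (P (fst p) 1 * \<psi> j (snd p)))"
    unfolding has_partial_def lift
  proof (intro ballI allI)
    fix p and w :: "nat \<Rightarrow> real"
    \<comment> \<open>Along coordinate \<open>j\<close> the field is a constant plus
      \<open>\<phi> t\<close> times \<open>\<psi> j\<close>; the constant is recovered from the
      value at \<open>t = 0\<close>.\<close>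
    have split: "a x (w(j := t)) = a x (w(j := 0)) - complex_of_real (\<phi> 0) * \<psi> j x + complex_of_real (\<phi> t) * \<psi> j x" for x t
    proof -
      have "(\<Sum>k=1..s. complex_of_real (\<phi> ((w(j := t)) k)) * \<psi> k x)
          = complex_of_real (\<phi> t) * \<psi> j x + (\<Sum>k\<in>{1..s} - {j}. complex_of_real (\<phi> (w k)) * \<psi> k x)" for t
        using j I by (subst sum.remove[of _ j]) (auto intro!: sum.cong)
      from this[of t] this[of 0] show ?thesis unfolding a by simp
    qed
    have "((\<lambda>t. complex_of_real (\<phi> t)) has_vector_derivative complex_of_real (\<phi>' (w j))) (at (w j))"
      using \<phi> by (intro has_vector_derivative_of_real) (simp add: has_real_derivative_iff_has_vector_derivative)
    from has_vector_derivative_mult_right[OF has_vector_derivative_add[OF has_vector_derivative_const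
          has_vector_derivative_mult_left[OF this]], of "P (fst p) 1"
        "a (snd p) (w(j := 0)) - complex_of_real (\<phi> 0) * \<psi> j (snd p)" "\<psi> j (snd p)"]
    have "((\<lambda>t. P (fst p) 1 * a (snd p) (w(j := t))) has_vector_derivative
        P (fst p) 1 * (complex_of_real (\<phi>' (w j)) * \<psi> j (snd p))) (at (w j))"
      by (simp only: split[symmetric] add_0_left)
    then show "((\<lambda>t. P (fst p) 1 * a (snd p) (w(j := t))) has_vector_derivative
        complex_of_real (\<phi>' (w j)) * (P (fst p) 1 * \<psi> j (snd p))) (at (w j))"
      by (simp only: mult.left_commute)
  qed
  with jets[of j n] j I show "\<exists>F'. has_partial (layer_measure d) j (\<lambda>p w. mat_vec 1 P (\<lambda>_. a (snd p) w) (fst p)) F' \<and>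
      jet n (layer_measure d) (incr j (\<lambda>_. 0)) (fps_const (\<beta> j) * 1) F'"
    by (intro exI[of _ "\<lambda>p w. complex_of_real (\<phi>' (w j)) * (P (fst p) 1 * \<psi> j (snd p))"] conjI) simp_all
qed

lemma smooth_pre_act:
  fixes \<theta> :: "'d::finite fno_params"
  assumes I: "finite I" and freqs: "finite (freqs \<theta>)" and \<xi>: "\<xi> > 0"
    and widths: "\<And>l. l \<in> {1..L + 1} \<Longrightarrow> width \<theta> l \<ge> 1"
    and layer_le: "\<And>l. l \<in> {1..L} \<Longrightarrow>
        mat_inf_norm (width \<theta> (l + 1)) (width \<theta> l) (weight \<theta> l)
          + (\<Sum>h\<in>freqs \<theta>. mat_inf_norm (width \<theta> (l + 1)) (width \<theta> l) (kernel_hat \<theta> l h)) \<le> R l"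
    and \<sigma>: "\<And>k t. ((deriv ^^ k) \<sigma> has_real_derivative (deriv ^^ Suc k) \<sigma> t) (at t)"
    and \<sigma>_le: "\<And>k t. k \<ge> 1 \<Longrightarrow> \<bar>(deriv ^^ k) \<sigma> t\<bar> \<le> \<xi> * \<tau> ^ k * fact k"
    and lift: "smooth (layer_measure (width \<theta> 1)) 1
      (\<lambda>p w. mat_vec 1 (cmat (lift_mat \<theta>)) (\<lambda>_. a (snd p) w) (fst p))"
  shows "Suc l \<le> L \<Longrightarrow> smooth (layer_measure (width \<theta> (Suc (Suc l))))
    (fps_const (Pi_const \<xi> \<tau> R (Suc l)) * geometric_fps (S_const \<xi> \<tau> R (Suc l)) ^ 2)
    (\<lambda>p w. complex_act \<sigma> (pre_act \<theta> \<sigma> (\<lambda>z. a z w) (Suc l) (snd p) (fst p)))"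
proof (induction l)
  \<comment> \<open>Layer \<open>l'\<close> maps dimension \<open>width \<theta> l'\<close> to
    \<open>width \<theta> (Suc l')\<close>, so its output carries the shifted index.\<close>
  have step: "smooth (layer_measure (width \<theta> (Suc l')))
      (fps_const (Pi_const \<xi> \<tau> R l') * geometric_fps (S_const \<xi> \<tau> R l') ^ 2)
      (\<lambda>p w. complex_act \<sigma> (fno_layer \<theta> l' (\<lambda>x i. v (i, x) w) (snd p) (fst p)))"
    if l': "l' = Suc l" "l' \<le> L" and v: "smooth (layer_measure (width \<theta> l'))
      (fps_const (Pi_const \<xi> \<tau> R l) * geometric_fps (S_const \<xi> \<tau> R l) ^ 2) v" for l l' v
  proof -
    define T where "T = (\<lambda>u (i, x :: real ^ 'd). mat_vec (width \<theta> l') (cmat (weight \<theta> l')) (\<lambda>j. u (j, x)) i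
      + kernel_op \<theta> l' (\<lambda>x j. u (j, x)) x i)"
    have "bounded_operator (layer_measure (width \<theta> l')) (layer_measure (width \<theta> (l' + 1))) (R l') T"
      unfolding T_def using l' by (intro bounded_operator_fno_layer freqs widths layer_le) auto
    from smooth_operator[OF I this v]
    have "smooth (layer_measure (width \<theta> (Suc l')))
        (fps_const (R l' * Pi_const \<xi> \<tau> R l) * geometric_fps (S_const \<xi> \<tau> R l) ^ 2) (\<lambda>q w. T (\<lambda>p. v p w) q)"
      by (simp only: mult.assoc[symmetric] fps_const_mult Suc_eq_plus1)
    moreover have "admissible (layer_measure (width \<theta> (Suc l')) :: (nat \<times> (real ^ 'd)) measure)
        (\<lambda>p. complex_of_real (bias \<theta> l' (fst p)))"
      unfolding admissible_def borel_measurable_layer_measure_iff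
    proof (intro conjI exI ballI)
      show "norm (complex_of_real (bias \<theta> l' (fst p))) \<le> (\<Sum>i\<in>{1..width \<theta> (Suc l')}. \<bar>bias \<theta> l' i\<bar>)"
        if "p \<in> space (layer_measure (width \<theta> (Suc l')) :: (nat \<times> (real ^ 'd)) measure)" for p
        using that unfolding space_layer_measure by (auto intro!: member_le_sum)
    qed simp
    ultimately have "smooth (layer_measure (width \<theta> (Suc l')))
        (fps_const (R l' * Pi_const \<xi> \<tau> R l) * geometric_fps (S_const \<xi> \<tau> R l) ^ 2)
        (\<lambda>q w. T (\<lambda>p. v p w) q + complex_of_real (bias \<theta> l' (fst q)))"
      by (rule smooth_add_const)
    from smooth_complex_act_geometric[where \<sigma> = "\<lambda>k. (deriv ^^ k) \<sigma>", OF \<sigma> \<sigma>_le this]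
    have "smooth (layer_measure (width \<theta> (Suc l')))
        (fps_const (\<xi> * \<tau> * (R l' * Pi_const \<xi> \<tau> R l))
          * geometric_fps (S_const \<xi> \<tau> R l + \<tau> * (R l' * Pi_const \<xi> \<tau> R l)) ^ 2)
        (\<lambda>p w. complex_act \<sigma> (T (\<lambda>p. v p w) p + complex_of_real (bias \<theta> l' (fst p))))"
      by simp
    moreover have "\<xi> * \<tau> * (R l' * Pi_const \<xi> \<tau> R l) = Pi_const \<xi> \<tau> R l'"
      by (simp add: Pi_const_def l' mult_ac)
    \<comment> \<open>The increment is \<open>Pi_const \<xi> \<tau> R l' / \<xi>\<close>, the next
      summand of S; this is where the factor \<open>1 / \<xi>\<close> in S originates.\<close>
    moreover have "S_const \<xi> \<tau> R l + \<tau> * (R l' * Pi_const \<xi> \<tau> R l) = S_const \<xi> \<tau> R l'"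
      using \<xi> by (simp add: S_const_def Pi_const_def l' field_simps)
    ultimately show ?thesis
      by (simp add: T_def fno_layer_def case_prod_beta)
  qed
  {
    case 0
    \<comment> \<open>The lift plays the part of layer 0: the empty product is 1 and the empty sum
      is 0, so the majorant is t.\<close>
    have "geometric_fps 0 = 1"
      by (rule fps_ext) (simp add: power_0_left)
    then have "smooth (layer_measure (width \<theta> 1)) (fps_const (Pi_const \<xi> \<tau> R 0) * geometric_fps (S_const \<xi> \<tau> R 0) ^ 2)
        (\<lambda>p w. mat_vec 1 (cmat (lift_mat \<theta>)) (\<lambda>_. a (snd p) w) (fst p))"
      using lift by (simp add: Pi_const_def S_const_def)
    from step[OF _ _ this] 0 show ?case by simp
  next
    case (Suc l)
    from step[OF _ _ Suc.IH] Suc.prems show ?case by simp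
  }
qed

end

section \<open>Bounds for the network\<close>

text \<open>Translation from jets to the norms of the theorem. Order zero stands apart because
  \<open>smooth\<close> bounds the values only locally.\<close>

lemma (in jets) field_norm_deriv_y:
  fixes G :: "real ^ 'd::finite \<Rightarrow> (nat \<Rightarrow> real) \<Rightarrow> nat \<Rightarrow> complex"
  assumes I: "I = {1..s}" and m: "m \<ge> 1"
    and G: "smooth (layer_measure m) (fps_deriv M) (\<lambda>p w. G (snd p) w (fst p))"
  shows "field_norm m s G < \<infinity>"
    and "x \<in> cbox 0 1 \<Longrightarrow> i \<in> {1..m} \<Longrightarrow> has_all_partials s (\<lambda>y. G x y i)"
    and "mi_order s \<nu> = 0 \<Longrightarrow> deriv_y s \<nu> G = G"
    and "mi_order s \<nu> \<noteq> 0 \<Longrightarrow> field_norm m s (deriv_y s \<nu> G) \<le>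
      ennreal (jet_bound (rev (concat (map (\<lambda>j. replicate (\<nu> j) j) [1..<Suc s]))) (\<lambda>_. 0) M)"
proof -
  define F where "F = (\<lambda>(p :: nat \<times> (real ^ 'd)) w. G (snd p) w (fst p))"
  define js where "js = concat (map (\<lambda>j. replicate (\<nu> j) j) [1..<Suc s])"
  have F: "smooth (layer_measure m) (fps_deriv M) F"
    using G by (simp only: F_def)
  have in_space: "(i, x) \<in> space (layer_measure m)" if "x \<in> cbox 0 1" "i \<in> {1..m}" for x :: "real ^ 'd" and i
    unfolding space_layer_measure using that by blast
  have partials: "has_partial (layer_measure m) j (foldr two_sided_partial ks F) (foldr two_sided_partial (j # ks) F)"
    if "set ks \<subseteq> {1..s}" "j \<in> {1..s}" for ks j
    using smooth_foldr_two_sided_partial(1)[OF F] that I by blast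
  have eq: "foldr partial_y ks (\<lambda>y. G x y i) y = foldr two_sided_partial ks F (i, x) y"
    if "x \<in> cbox 0 1" "i \<in> {1..m}" "set ks \<subseteq> {1..s}" "y \<in> param_cube s" for x i ks y
    using foldr_partial_y_eq[OF partials in_space that(3,4), of x i] that(1,2) by (simp add: F_def)
  \<comment> \<open>The box of radius 1 contains the parameter cube.\<close>
  obtain B where B: "\<forall>p\<in>space (layer_measure m). \<forall>w. (\<forall>j\<in>I. \<bar>w j\<bar> \<le> 1) \<longrightarrow> norm (F p w) \<le> B"
    using F unfolding smooth_def by blast
  have "field_norm m s G \<le> ennreal B"
  proof (rule field_norm_leI[OF m])
    fix x :: "real ^ 'd" and y i assume xy: "x \<in> cbox 0 1" "y \<in> param_cube s" "i \<in> {1..m}"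
    have "\<forall>j\<in>I. \<bar>y j\<bar> \<le> 1"
      using xy(2) I by (auto simp: param_cube_def PiE_iff)
    with bspec[OF B in_space[OF xy(1,3)]] show "norm (G x y i) \<le> B"
      by (simp add: F_def)
  qed
  then show "field_norm m s G < \<infinity>"
    by (rule order_le_less_trans) simp
  show "has_all_partials s (\<lambda>y. G x y i)" if "x \<in> cbox 0 1" "i \<in> {1..m}"
    unfolding has_all_partials_def
  proof (intro allI impI ballI)
    fix ks j y assume ks: "set ks \<subseteq> {1..s}" and j: "j \<in> {1..s}" and y: "y \<in> param_cube s"
    show "(\<lambda>t. foldr partial_y ks (\<lambda>y. G x y i) (y(j := t))) differentiable at (y j) within {0..1}"
      using has_vector_derivative_within_cube[OF partials[OF ks j] in_space[OF that] y j eq[OF that ks]]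
      by (rule differentiableI_vector)
  qed
  have js: "set js \<subseteq> {1..s}"
    by (auto simp: js_def)
  have js_Nil: "js = [] \<longleftrightarrow> mi_order s \<nu> = 0"
    by (auto simp: js_def mi_order_def)
  have deriv_y: "deriv_y s \<nu> G x y i = foldr partial_y js (\<lambda>y. G x y i) y" for x y i
    by (simp add: deriv_y_def mixed_partial_foldr js_def)
  show "deriv_y s \<nu> G = G" if "mi_order s \<nu> = 0"
    using js_Nil that by (intro ext) (simp add: deriv_y)
  show "field_norm m s (deriv_y s \<nu> G) \<le> ennreal (jet_bound (rev (concat (map (\<lambda>j. replicate (\<nu> j) j) [1..<Suc s]))) (\<lambda>_. 0) M)"
    if "mi_order s \<nu> \<noteq> 0"
    unfolding js_def[symmetric]
  proof (rule field_norm_leI[OF m])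
    fix x :: "real ^ 'd" and y i assume xy: "x \<in> cbox 0 1" "y \<in> param_cube s" "i \<in> {1..m}"
    show "norm (deriv_y s \<nu> G x y i) \<le> jet_bound (rev js) (\<lambda>_. 0) M"
      unfolding deriv_y eq[OF xy(1,3) js xy(2)] using js js_Nil that I
      by (intro smooth_foldr_two_sided_partial(2)[OF F _ _ in_space[OF xy(1,3)]]) auto
  qed
qed

section \<open>The bounds in closed form and the theorem\<close>

lemma mi_power_scale: "mi_power s (\<lambda>j. c * S * b j) k = S ^ mi_order s k * mi_power s (\<lambda>j. c * b j) k"
  by (simp add: mi_power_def mi_order_def power_mult_distrib prod.distrib power_sum mult_ac)

lemma prod_list_replicate_mi_power:
  "prod_list (map b (concat (map (\<lambda>j. replicate (\<nu> j) j) [1..<Suc s]))) = mi_power s b \<nu>"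
  by (induction s) (auto simp: mi_power_def prod_list_replicate simp del: upt_Suc simp add: upt_Suc_append mult.commute)

lemma length_concat_replicate: "length (concat (map (\<lambda>j. replicate (\<nu> j) j) [1..<Suc s])) = mi_order s \<nu>"
  by (induction s) (auto simp: mi_order_def)

lemma jet_bound_affine_field:
  "jets.jet_bound 0 (\<lambda>j. p * \<beta> j) (rev (concat (map (\<lambda>j. replicate (\<nu> j) j) [1..<Suc s]))) m (fps_const K * geometric_fps S)
    = K * (fact (mi_order s \<nu>) * mi_power s (\<lambda>j. p * S * \<beta> j) \<nu>)"
  unfolding jets.jet_bound_affine[OF refl] rev_map[symmetric] prod_list.rev length_rev prod_list_replicate_mi_power
    length_concat_replicate mi_power_scale
  by simp

text \<open>Hitting the prefactor \<open>\<nu> j - k j\<close> times and the series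
  \<open>k j\<close> times gives a factor 2 pi each time, hence the common power
  \<open>mi_order s \<nu>\<close>. The power of \<open>S\<close> in the coefficient is distributed
  over the weights.\<close>

lemma jet_bound_chebyshev_field:
  "jets.jet_bound (2 * pi) (\<lambda>j. 2 * pi * (p * \<beta> j))
      (rev (concat (map (\<lambda>j. replicate (\<nu> j) j) [1..<Suc s]))) (\<lambda>_. 0) (fps_const K * geometric_fps S)
    = K * ((2 * pi) ^ mi_order s \<nu> * (\<Sum>k\<in>mi_below s \<nu>. fact (mi_order s k)
        * mi_power s (\<lambda>j. p * S * \<beta> j) k * real (mi_Stirling s \<nu> k)))"
proof -
  have prod: "(\<Prod>j=1..s. real (Stirling (\<nu> j) (k j)) * (2 * pi) ^ (\<nu> j - k j) * (2 * pi * (p * \<beta> j)) ^ k j)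
      = (2 * pi) ^ mi_order s \<nu> * (mi_power s (\<lambda>j. p * \<beta> j) k * real (mi_Stirling s \<nu> k))"
    if k: "k \<in> mi_below s \<nu>" for k
  proof -
    have "(\<Prod>j=1..s. real (Stirling (\<nu> j) (k j)) * (2 * pi) ^ (\<nu> j - k j) * (2 * pi * (p * \<beta> j)) ^ k j)
        = (\<Prod>j=1..s. (2 * pi) ^ \<nu> j * ((p * \<beta> j) ^ k j * real (Stirling (\<nu> j) (k j))))"
    proof (rule prod.cong[OF refl])
      fix j assume "j \<in> {1..s}"
      then have "k j \<le> \<nu> j"
        using k by (auto simp: mi_below_def PiE_iff)
      then have "(2 * pi) ^ \<nu> j = (2 * pi) ^ (\<nu> j - k j) * (2 * pi) ^ k j"
        by (simp only: power_add[symmetric] le_add_diff_inverse2)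
      then show "real (Stirling (\<nu> j) (k j)) * (2 * pi) ^ (\<nu> j - k j) * (2 * pi * (p * \<beta> j)) ^ k j
          = (2 * pi) ^ \<nu> j * ((p * \<beta> j) ^ k j * real (Stirling (\<nu> j) (k j)))"
        by (simp only: power_mult_distrib mult_ac)
    qed
    then show ?thesis
      by (simp only: prod.distrib mi_power_def mi_Stirling_def mi_order_def power_sum of_nat_prod)
  qed
  show ?thesis
    unfolding jets.jet_bound_mixed[OF refl] sum_distrib_left mi_power_scale
  proof (rule sum.cong[OF refl])
    fix k assume k: "k \<in> mi_below s \<nu>"
    show "(\<Prod>j=1..s. real (Stirling (\<nu> j) (k j)) * (2 * pi) ^ (\<nu> j - k j) * (2 * pi * (p * \<beta> j)) ^ k j)
        * (fact (mi_order s k) * (fps_const K * geometric_fps S) $ mi_order s k)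
      = K * ((2 * pi) ^ mi_order s \<nu> * (fact (mi_order s k)
        * (S ^ mi_order s k * mi_power s (\<lambda>j. p * \<beta> j) k) * real (mi_Stirling s \<nu> k)))"
      unfolding prod[OF k] fps_mult_left_const_nth geometric_fps_nth by (simp only: mult_ac)
  qed
qed

theorem theorem1:
  fixes L s :: nat
    and \<theta> :: "('d::finite) fno_params"
    and \<sigma> :: "real \<Rightarrow> real"
    and \<psi> :: "nat \<Rightarrow> real ^ 'd \<Rightarrow> complex"
    and a :: "real ^ 'd \<Rightarrow> (nat \<Rightarrow> real) \<Rightarrow> complex"
    and \<beta> R A :: "nat \<Rightarrow> real"
    and \<xi> \<tau> :: real
  assumes L: "L \<ge> 1"
    and widths: "\<And>l. l \<in> {1..L + 1} \<Longrightarrow> width \<theta> l \<ge> 1"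
    and out_dim: "out_dim \<theta> \<ge> 1"
    and freqs: "finite (freqs \<theta>)"
    and psi_measurable: "\<And>j. j \<le> s \<Longrightarrow> \<psi> j \<in> borel_measurable (lebesgue_on (cbox 0 1))"
    and psi_bounded: "\<And>j. j \<le> s \<Longrightarrow> bounded (\<psi> j ` cbox 0 1)"
    and sigma_smooth: "\<And>n. (deriv ^^ n) \<sigma> differentiable_on UNIV"
    and field: "a = affine_field s \<psi> \<or> a = chebyshev_field s \<psi>"
    and beta_pos: "\<And>j. j \<ge> 1 \<Longrightarrow> \<beta> j > 0"
    and R_pos: "\<And>l. l \<ge> 1 \<Longrightarrow> R l > 0"
    and A_pos: "\<And>n. n \<ge> 1 \<Longrightarrow> A n > 0"
    and psi_le: "\<And>j. j \<in> {1..s} \<Longrightarrow> sup_norm (cbox 0 1) (\<psi> j) \<le> ennreal (\<beta> j)"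
    and layer_le: "\<And>l. l \<in> {1..L} \<Longrightarrow>
        mat_inf_norm (width \<theta> (l + 1)) (width \<theta> l) (weight \<theta> l)
          + (\<Sum>h\<in>freqs \<theta>. mat_inf_norm (width \<theta> (l + 1)) (width \<theta> l) (kernel_hat \<theta> l h)) \<le> R l"
    and sigma_le: "\<And>n. n \<ge> 1 \<Longrightarrow> sup_norm UNIV ((deriv ^^ n) \<sigma>) \<le> ennreal (A n)"
    and xi: "\<xi> > 0" and tau: "\<tau> > 0"
    and A_eq: "\<And>n. n \<ge> 1 \<Longrightarrow> A n = \<xi> * \<tau> ^ n * fact n"
  shows
    "field_norm (out_dim \<theta>) s (fno L \<theta> \<sigma> a) < \<infinity>
     \<and> (\<forall>x\<in>cbox 0 1. \<forall>i\<in>{1..out_dim \<theta>}. has_all_partials s (\<lambda>y. fno L \<theta> \<sigma> a x y i))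
     \<and> (\<forall>\<nu> :: nat \<Rightarrow> nat.
          (a = affine_field s \<psi> \<longrightarrow>
             field_norm (out_dim \<theta>) s (deriv_y s \<nu> (fno L \<theta> \<sigma> a))
               \<le> C_const L \<theta> \<sigma> s a \<xi> \<tau> R
                   * ennreal (fact (mi_order s \<nu>)
                       * mi_power s (\<lambda>j. mat_inf_norm (width \<theta> 1) 1 (lift_mat \<theta>)
                                           * S_const \<xi> \<tau> R L * \<beta> j) \<nu>))
        \<and> (a = chebyshev_field s \<psi> \<longrightarrow>
             field_norm (out_dim \<theta>) s (deriv_y s \<nu> (fno L \<theta> \<sigma> a))
               \<le> C_const L \<theta> \<sigma> s a \<xi> \<tau> R
                   * ennreal ((2 * pi) ^ mi_order s \<nu>
                       * (\<Sum>m\<in>mi_below s \<nu>.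
                            fact (mi_order s m)
                              * mi_power s (\<lambda>j. mat_inf_norm (width \<theta> 1) 1 (lift_mat \<theta>)
                                                  * S_const \<xi> \<tau> R L * \<beta> j) m
                              * real (mi_Stirling s \<nu> m)))))"
proof -
  define PiL where "PiL = Pi_const \<xi> \<tau> R L"
  define S where "S = S_const \<xi> \<tau> R L"
  define q where "q = mat_inf_norm (out_dim \<theta>) (width \<theta> (L + 1)) (proj_mat \<theta>)"
  define p where "p = mat_inf_norm (width \<theta> 1) 1 (lift_mat \<theta>)"
  \<comment> \<open>The projected majorant q PiL t / (1 - S t) differs from K / (1 - S t) by the
    constant K. The latter has coefficients K S^n, whence the quotient in C_L.\<close>
  define K where "K = q * (PiL / S)"
  define M where "M = fps_const K * geometric_fps S"
  define G where "G = fno L \<theta> \<sigma> a"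
  let ?js = "\<lambda>\<nu>. rev (concat (map (\<lambda>j. replicate (\<nu> j) j) [1..<Suc s]))"
  have Pi_pos: "Pi_const \<xi> \<tau> R k > 0" for k
    unfolding Pi_const_def using xi tau R_pos by (intro prod_pos) auto
  have S_pos: "S > 0"
    unfolding S_def S_const_def using xi L Pi_pos by (auto intro!: mult_pos_pos divide_pos_pos sum_pos)
  have q: "q \<ge> 0" and p: "p \<ge> 0"
    unfolding q_def p_def using out_dim widths[of 1] L by (auto intro!: mat_inf_norm_nonneg)
  have K: "K \<ge> 0"
    unfolding K_def PiL_def using q S_pos Pi_pos[of L] by (intro mult_nonneg_nonneg divide_nonneg_nonneg) auto
  have M: "fps_deriv M = fps_const q * (fps_const PiL * geometric_fps S ^ 2)"
    using S_pos by (simp add: M_def K_def fps_deriv_geometric_fps flip: mult.assoc)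
  have \<sigma>: "((deriv ^^ k) \<sigma> has_real_derivative (deriv ^^ Suc k) \<sigma> t) (at t)" for k t
    using sigma_smooth[of k] by (simp add: DERIV_deriv_iff_real_differentiable differentiable_on_def)
  have \<sigma>_le: "\<bar>(deriv ^^ k) \<sigma> t\<bar> \<le> \<xi> * \<tau> ^ k * fact k" if "k \<ge> 1" for k t
    using sup_norm_le_ennrealD[OF sigma_le[OF that] UNIV_I] A_pos[OF that] A_eq[OF that] by simp
  have lift_le: "norm (cmat (lift_mat \<theta>) (fst z) 1 * \<psi> j (snd z)) \<le> p * \<beta> j"
    if "j \<in> {1..s}" and z: "z \<in> space (layer_measure (width \<theta> 1) :: (nat \<times> (real ^ 'd)) measure)" for j z
  proof -
    have z: "fst z \<in> {1..width \<theta> 1}" "snd z \<in> cbox 0 1"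
      using z unfolding space_layer_measure by auto
    have "norm (cmat (lift_mat \<theta>) (fst z) 1) \<le> p"
      using mat_inf_norm_ge[OF z(1), where n = 1 and M = "lift_mat \<theta>"] by (simp add: p_def cmat_def)
    moreover have "norm (\<psi> j (snd z)) \<le> \<beta> j"
      using sup_norm_le_ennrealD[OF psi_le z(2)] beta_pos[of j] that(1) by auto
    ultimately show ?thesis
      unfolding norm_mult by (rule mult_mono') auto
  qed
  have lift_meas: "(\<lambda>z. cmat (lift_mat \<theta>) (fst z) 1 * \<psi> j (snd z)) \<in> borel_measurable (layer_measure (width \<theta> 1))"
    if "j \<in> {1..s}" for j
    unfolding borel_measurable_layer_measure_iff fst_conv snd_conv using that
    by (intro ballI borel_measurable_times borel_measurable_const psi_measurable) auto
  have smooth: "jets.smooth {1..s} \<alpha> b (layer_measure (out_dim \<theta>)) (fps_deriv M) (\<lambda>p w. G (snd p) w (fst p))"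
    if lift: "jets.smooth {1..s} \<alpha> b (layer_measure (width \<theta> 1)) 1
      (\<lambda>p w. mat_vec 1 (cmat (lift_mat \<theta>)) (\<lambda>_. a (snd p) w) (fst p))" for \<alpha> b
  proof -
    interpret jets "{1..s}" \<alpha> b .
    obtain l where l: "L = Suc l"
      using L by (cases L) auto
    have pre_act: "smooth (layer_measure (width \<theta> (L + 1))) (fps_const PiL * geometric_fps S ^ 2)
        (\<lambda>p w. complex_act \<sigma> (pre_act \<theta> \<sigma> (\<lambda>z. a z w) L (snd p) (fst p)))"
      using smooth_pre_act[OF _ freqs xi widths layer_le \<sigma> \<sigma>_le lift, where L = L and l = l] l by (simp add: PiL_def S_def)
    have proj: "bounded_operator (layer_measure (width \<theta> (L + 1))) (layer_measure (out_dim \<theta>)) q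
        (\<lambda>u (i, x :: real ^ 'd). mat_vec (width \<theta> (L + 1)) (cmat (proj_mat \<theta>)) (\<lambda>j. u (j, x)) i)"
      unfolding q_def mat_inf_norm_cmat[symmetric] using widths[of "L + 1"]
      by (intro bounded_operator_mat_vec) simp
    show ?thesis
      using smooth_operator[OF finite_atLeastAtMost proj pre_act]
      by (simp only: M G_def fno_def case_prod_beta fst_conv snd_conv)
  qed
  have C: "C_const L \<theta> \<sigma> s a \<xi> \<tau> R = max (field_norm (out_dim \<theta>) s G) (ennreal K)"
    by (simp add: C_const_def K_def q_def PiL_def S_def G_def)
  \<comment> \<open>The first entry of the maximum settles order zero, the second all positive
    orders. The distinction is by \<open>mi_order s \<nu>\<close>, since \<nu> may have nonzero
    entries outside \<open>1..s\<close>.\<close>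
  have bound: "field_norm (out_dim \<theta>) s (deriv_y s \<nu> G) \<le> C_const L \<theta> \<sigma> s a \<xi> \<tau> R * ennreal Y"
    if "mi_order s \<nu> = 0 \<Longrightarrow> deriv_y s \<nu> G = G \<and> Y = 1"
      and "mi_order s \<nu> \<noteq> 0 \<Longrightarrow> field_norm (out_dim \<theta>) s (deriv_y s \<nu> G) \<le> ennreal (K * Y)" for \<nu> Y
  proof (cases "mi_order s \<nu> = 0")
    case True
    then show ?thesis using that(1) by (simp add: C)
  next
    case False
    have "ennreal (K * Y) = ennreal K * ennreal Y"
      using K by (rule ennreal_mult')
    also have "\<dots> \<le> C_const L \<theta> \<sigma> s a \<xi> \<tau> R * ennreal Y"
      by (intro mult_right_mono) (auto simp: C)
    finally show ?thesis using that(2)[OF False] by (rule order_trans[rotated])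
  qed
  have zero: "\<nu> j = 0" if "mi_order s \<nu> = 0" "j \<in> {1..s}" for \<nu> j
    using that by (simp add: mi_order_def)
  have affine: "field_norm (out_dim \<theta>) s G < \<infinity> \<and>
      (\<forall>x\<in>cbox 0 1. \<forall>i\<in>{1..out_dim \<theta>}. has_all_partials s (\<lambda>y. G x y i)) \<and>
      (\<forall>\<nu>. field_norm (out_dim \<theta>) s (deriv_y s \<nu> G) \<le> C_const L \<theta> \<sigma> s a \<xi> \<tau> R
        * ennreal (fact (mi_order s \<nu>) * mi_power s (\<lambda>j. p * S * \<beta> j) \<nu>))"
    if a: "a = affine_field s \<psi>"
  proof -
    interpret jets "{1..s}" 0 "\<lambda>j. p * \<beta> j" .
    have "smooth (layer_measure (width \<theta> 1)) 1
        (\<lambda>p w. mat_vec 1 (cmat (lift_mat \<theta>)) (\<lambda>_. a (snd p) w) (fst p))"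
    proof (rule smooth_lift[OF refl psi_measurable psi_bounded])
      show "((\<lambda>t. t - 1 / 2) has_real_derivative 1) (at t)" for t :: real
        by (auto intro!: derivative_eq_intros)
      show "a = (\<lambda>x y. \<psi> 0 x + (\<Sum>j=1..s. complex_of_real (y j - 1 / 2) * \<psi> j x))"
        by (simp add: a affine_field_def fun_eq_iff)
      show "jet n (layer_measure (width \<theta> 1)) (incr j (\<lambda>_. 0)) (fps_const (p * \<beta> j))
          (\<lambda>z w. complex_of_real 1 * (cmat (lift_mat \<theta>) (fst z) 1 * \<psi> j (snd z)))" if j: "j \<in> {1..s}" for n j
        using jet_const[OF refl lift_meas[OF j] lift_le[OF j]] by simp
    qed
    note * = field_norm_deriv_y[OF refl out_dim smooth[OF this]]
    have "field_norm (out_dim \<theta>) s (deriv_y s \<nu> G) \<le> C_const L \<theta> \<sigma> s a \<xi> \<tau> R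
        * ennreal (fact (mi_order s \<nu>) * mi_power s (\<lambda>j. p * S * \<beta> j) \<nu>)" for \<nu>
    proof (rule bound)
      show "deriv_y s \<nu> G = G \<and> fact (mi_order s \<nu>) * mi_power s (\<lambda>j. p * S * \<beta> j) \<nu> = 1" if "mi_order s \<nu> = 0"
        using *(3)[OF that] zero[OF that] that by (simp add: mi_power_def)
      show "field_norm (out_dim \<theta>) s (deriv_y s \<nu> G)
          \<le> ennreal (K * (fact (mi_order s \<nu>) * mi_power s (\<lambda>j. p * S * \<beta> j) \<nu>))" if "mi_order s \<nu> \<noteq> 0"
        using *(4)[OF that] unfolding M_def jet_bound_affine_field .
    qed
    with *(1,2) show ?thesis by blast
  qed
  have chebyshev: "field_norm (out_dim \<theta>) s G < \<infinity> \<and>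
      (\<forall>x\<in>cbox 0 1. \<forall>i\<in>{1..out_dim \<theta>}. has_all_partials s (\<lambda>y. G x y i)) \<and>
      (\<forall>\<nu>. field_norm (out_dim \<theta>) s (deriv_y s \<nu> G) \<le> C_const L \<theta> \<sigma> s a \<xi> \<tau> R
        * ennreal ((2 * pi) ^ mi_order s \<nu> * (\<Sum>m\<in>mi_below s \<nu>. fact (mi_order s m)
            * mi_power s (\<lambda>j. p * S * \<beta> j) m * real (mi_Stirling s \<nu> m))))"
    if a: "a = chebyshev_field s \<psi>"
  proof -
    \<comment> \<open>The weights are the derivatives of \<open>p * \<beta> j\<close> (e^(2 pi z) -
      1) at z = 0.\<close>
    interpret jets "{1..s}" "2 * pi" "\<lambda>j. 2 * pi * (p * \<beta> j)" .
    have "smooth (layer_measure (width \<theta> 1)) 1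
        (\<lambda>p w. mat_vec 1 (cmat (lift_mat \<theta>)) (\<lambda>_. a (snd p) w) (fst p))"
    proof (rule smooth_lift[OF refl psi_measurable psi_bounded])
      \<comment> \<open>The cosine is written as a shifted sine to match
        \<open>jet_sin\<close>.\<close>
      show "((\<lambda>t. sin (2 * pi * t)) has_real_derivative 2 * pi * sin (2 * pi * t + pi / 2)) (at t)" for t
        by (auto intro!: derivative_eq_intros simp: sin_add)
      show "a = (\<lambda>x y. \<psi> 0 x + (\<Sum>j=1..s. complex_of_real (sin (2 * pi * y j)) * \<psi> j x))"
        by (simp add: a chebyshev_field_def fun_eq_iff)
      show "jet n (layer_measure (width \<theta> 1)) (incr j (\<lambda>_. 0)) (fps_const (2 * pi * (p * \<beta> j)))
          (\<lambda>z w. complex_of_real (2 * pi * sin (2 * pi * w j + pi / 2)) * (cmat (lift_mat \<theta>) (fst z) 1 * \<psi> j (snd z)))"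
        if j: "j \<in> {1..s}" for n j
      proof -
        have "jet n (layer_measure (width \<theta> 1)) (incr j (\<lambda>_. 0)) (fps_const (2 * pi * (p * \<beta> j)))
            (\<lambda>z w. complex_of_real (sin (2 * pi * w j + pi / 2)) *
              (complex_of_real (2 * pi) * (cmat (lift_mat \<theta>) (fst z) 1 * \<psi> j (snd z))))"
        proof (rule jet_sin[OF refl borel_measurable_times[OF borel_measurable_const lift_meas[OF j]]])
          fix z assume z: "z \<in> space (layer_measure (width \<theta> 1) :: (nat \<times> (real ^ 'd)) measure)"
          show "norm (complex_of_real (2 * pi) * (cmat (lift_mat \<theta>) (fst z) 1 * \<psi> j (snd z))) \<le> 2 * pi * (p * \<beta> j)"
            unfolding norm_mult[of "complex_of_real (2 * pi)"] using lift_le[OF j z] by simp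
        qed
        then show ?thesis
          by (simp only: of_real_mult mult_ac)
      qed
    qed
    note * = field_norm_deriv_y[OF refl out_dim smooth[OF this]]
    have "field_norm (out_dim \<theta>) s (deriv_y s \<nu> G) \<le> C_const L \<theta> \<sigma> s a \<xi> \<tau> R
        * ennreal ((2 * pi) ^ mi_order s \<nu> * (\<Sum>m\<in>mi_below s \<nu>. fact (mi_order s m)
            * mi_power s (\<lambda>j. p * S * \<beta> j) m * real (mi_Stirling s \<nu> m)))" for \<nu>
    proof (rule bound)
      show "deriv_y s \<nu> G = G \<and> (2 * pi) ^ mi_order s \<nu> * (\<Sum>m\<in>mi_below s \<nu>. fact (mi_order s m)
          * mi_power s (\<lambda>j. p * S * \<beta> j) m * real (mi_Stirling s \<nu> m)) = 1" if "mi_order s \<nu> = 0"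
      proof -
        \<comment> \<open>Only the zero multiindex remains, and its Stirling product is 1.\<close>
        have "mi_below s \<nu> = {\<lambda>j\<in>{1..s}. 0}"
        proof -
          have "mi_below s \<nu> = (\<Pi>\<^sub>E j\<in>{1..s}. {0})"
            unfolding mi_below_def using zero[OF that] by (intro PiE_cong) simp
          then show ?thesis by (simp add: PiE_eq_singleton)
        qed
        then show ?thesis
          using *(3)[OF that] zero[OF that] that by (simp add: mi_power_def mi_order_def mi_Stirling_def)
      qed
      show "field_norm (out_dim \<theta>) s (deriv_y s \<nu> G) \<le> ennreal (K * ((2 * pi) ^ mi_order s \<nu>
          * (\<Sum>m\<in>mi_below s \<nu>. fact (mi_order s m)
            * mi_power s (\<lambda>j. p * S * \<beta> j) m * real (mi_Stirling s \<nu> m))))" if "mi_order s \<nu> \<noteq> 0"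
        using *(4)[OF that] unfolding M_def jet_bound_chebyshev_field .
    qed
    with *(1,2) show ?thesis by blast
  qed
  show ?thesis
    using field affine chebyshev unfolding G_def p_def S_def by blast
qed

end
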